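(* Let $Y_{n,k}$ be the number of nodes at distance $k$ from the root in a random recursive tree of $n$ nodes, let $W_n=\max_{k\ge 0}Y_{n,k}$, and let $k^*$ denote one of the levels such that $Y_{n,k^*}=W_n$. For every $B>0$ there exists $T_0>1$ such that $$\mathbb{P}(|k^*-L_n|\ge T)=O(T^{-B})$$ for $T>T_0$, where the implied constant does not depend on $n$ or $T$.
   Context: $L_n:=\max\{\log n,1\}$ (natural logarithm). A recursive tree of $n$ nodes is a rooted, nonplane tree with nodes labeled $1,\dots,n$ such that labels along every path down from the root are increasing; there are $(n-1)!$ of them. A random recursive tree of $n$ nodes is chosen uniformly among these. Equivalently: start with a root labeled $1$; for $i=2,\dots,n$, node $i$ is attached to a node chosen uniformly at random among the previous $i-1$ nodes. The root is at level $0$. *)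

theory Defs
  imports "HOL-Probability.Probability"
begin

text \<open>A rooted nonplane tree is a root together with a set of arcs directed away from the root;
  an arc \<open>(u, v)\<close> says that \<open>v\<close> is a child of \<open>u\<close>. Children are unordered.\<close>

type_synonym 'a rooted_graph = "'a \<times> 'a rel"

definition rooted_tree :: "'a set \<Rightarrow> 'a rooted_graph \<Rightarrow> bool" where
  "rooted_tree V = (\<lambda>(r, E). r \<in> V \<and> E \<subseteq> V \<times> V \<and>
     (\<forall>v\<in>V. (r, v) \<in> E\<^sup>*) \<and>
     (\<forall>u. (u, r) \<notin> E) \<and>
     (\<forall>v\<in>V - {r}. \<exists>!u. (u, v) \<in> E))"

definition recursive_trees :: "nat \<Rightarrow> nat rooted_graph set" where
  "recursive_trees n = {(r, E). rooted_tree {1..n} (r, E) \<and> (\<forall>(u, v)\<in>E\<^sup>+. u < v)}"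

definition random_recursive_tree :: "nat \<Rightarrow> nat rooted_graph pmf" where
  "random_recursive_tree n = pmf_of_set (recursive_trees n)"

definition root_dist :: "'a rooted_graph \<Rightarrow> 'a \<Rightarrow> nat" where
  "root_dist = (\<lambda>(r, E) v. LEAST k. (r, v) \<in> E ^^ k)"

definition profile :: "nat \<Rightarrow> nat rooted_graph \<Rightarrow> nat \<Rightarrow> nat" where
  "profile n t k = card {v \<in> {1..n}. root_dist t v = k}"

definition width :: "nat \<Rightarrow> nat rooted_graph \<Rightarrow> nat" where
  "width n t = Max (range (profile n t))"

definition L :: "nat \<Rightarrow> real" where
  "L n = max (ln (real n)) 1"

text \<open>The next lemma in particular justifies the use of \<^const>\<open>pmf_of_set\<close>, which is only
  meaningful for finite nonempty sets.\<close>

lemma bij_betw_parent_recursive_trees: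
  assumes "n \<ge> 1"
  shows "bij_betw (\<lambda>p. (1, (\<lambda>i. (p i, i)) ` {2..n}))
    (\<Pi>\<^sub>E i\<in>{2..n}. {1..<i}) (recursive_trees n)"
  unfolding bij_betw_def
proof
  let ?F = "\<lambda>p :: nat \<Rightarrow> nat. (1::nat, (\<lambda>i. (p i, i)) ` {2..n})"
  let ?P = "\<Pi>\<^sub>E i\<in>{2..n}. {1..<i::nat}"
  show "inj_on ?F ?P"
  proof (rule inj_onI)
    fix p q assume p: "p \<in> ?P" and q: "q \<in> ?P" and "?F p = ?F q"
    then have eq: "(\<lambda>i. (p i, i)) ` {2..n} = (\<lambda>i. (q i, i)) ` {2..n}" by simp
    have "p i = q i" if "i \<in> {2..n}" for i
    proof -
      have "(p i, i) \<in> (\<lambda>i. (q i, i)) ` {2..n}" using that eq by blast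
      then show ?thesis by auto
    qed
    then show "p = q" using p q by (metis PiE_ext)
  qed
  show "?F ` ?P = recursive_trees n"
  proof (intro equalityI subsetI)
    fix t assume "t \<in> ?F ` ?P"
    then obtain p where p: "p \<in> ?P" and t: "t = ?F p" by blast
    define E where "E = (\<lambda>i. (p i, i)) ` {2..n}"
    have pi: "1 \<le> p i \<and> p i < i" if "i \<in> {2..n}" for i
      using PiE_mem[OF p that] by simp
    have lt: "u < v" if "(u, v) \<in> E\<^sup>+" for u v
      using that
    proof (induction rule: trancl_induct)
      case (base y)
      then show ?case using pi unfolding E_def by auto
    next
      case (step y z)
      have "y < z" using step(2) pi unfolding E_def by auto
      then show ?case using step by simp
    qed
    have reach: "v \<in> {1..n} \<longrightarrow> (1, v) \<in> E\<^sup>*" for v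
    proof (induction v rule: less_induct)
      case (less v)
      show ?case
      proof (cases "v \<in> {2..n}")
        case True
        then have "(1, p v) \<in> E\<^sup>*" using less pi[OF True] by auto
        moreover have "(p v, v) \<in> E" using True unfolding E_def by blast
        ultimately show ?thesis by (meson rtrancl.rtrancl_into_rtrancl)
      next
        case False
        then have "v \<in> {1..n} \<longrightarrow> v = 1" by auto
        then show ?thesis by auto
      qed
    qed
    have sub: "E \<subseteq> {1..n} \<times> {1..n}" using pi unfolding E_def by force
    have root: "\<forall>u. (u, 1) \<notin> E" unfolding E_def by auto
    have uniq: "\<exists>!u. (u, v) \<in> E" if "v \<in> {1..n} - {1}" for v
    proof (rule ex1I)
      show "(p v, v) \<in> E" using that unfolding E_def by force
      show "u = p v" if "(u, v) \<in> E" for u using that unfolding E_def by auto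
    qed
    show "t \<in> recursive_trees n"
      unfolding recursive_trees_def rooted_tree_def t E_def[symmetric] mem_Collect_eq prod.case
      using assms lt reach sub root uniq by (intro conjI ballI) auto
  next
    fix t assume t: "t \<in> recursive_trees n"
    obtain r E where tE: "t = (r, E)" by fastforce
    have lt: "u < v" if "(u, v) \<in> E" for u v
      using t that r_into_trancl[OF that] unfolding recursive_trees_def tE by blast
    have sub: "E \<subseteq> {1..n} \<times> {1..n}" and root: "\<And>u. (u, r) \<notin> E" and r: "r \<in> {1..n}"
      and uniq: "\<And>v. v \<in> {1..n} - {r} \<Longrightarrow> \<exists>!u. (u, v) \<in> E"
      using t unfolding recursive_trees_def rooted_tree_def tE by simp_all
    have r1: "r = 1"
    proof (rule ccontr)
      assume "r \<noteq> 1"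
      then obtain u where "(u, 1) \<in> E" using uniq[of 1] assms by auto
      then show False using lt sub by fastforce
    qed
    define p where "p = restrict (\<lambda>v. THE u. (u, v) \<in> E) {2..n}"
    have pE: "(p v, v) \<in> E" if "v \<in> {2..n}" for v
      using theI'[OF uniq[of v]] that r1 unfolding p_def by simp
    have "p \<in> ?P"
    proof (rule PiE_I)
      fix i assume "i \<in> {2..n}"
      then have "(p i, i) \<in> E" by (rule pE)
      moreover from this have "p i \<in> {1..n}" using sub by blast
      ultimately show "p i \<in> {1..<i}" using lt by simp
    qed (simp only: p_def restrict_def if_False)
    moreover have "E = (\<lambda>i. (p i, i)) ` {2..n}"
    proof (intro equalityI subsetI)
      fix e assume e: "e \<in> E"
      obtain u v where uv: "e = (u, v)" by fastforce
      have "v \<in> {1..n}" "v \<noteq> 1" using e uv sub root r1 by auto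
      then have v: "v \<in> {2..n}" by auto
      then have "v \<in> {1..n} - {r}" using r1 by auto
      then have "u = p v" using uniq pE[OF v] e uv by blast
      then show "e \<in> (\<lambda>i. (p i, i)) ` {2..n}" using v uv by blast
    qed (use pE in auto)
    ultimately show "t \<in> ?F ` ?P" using tE r1 by blast
  qed
qed

lemma card_recursive_trees:
  assumes "n \<ge> 1"
  shows "card (recursive_trees n) = fact (n - 1)"
proof -
  have "card (recursive_trees n) = card (\<Pi>\<^sub>E i\<in>{2..n}. {1..<i::nat})"
    using bij_betw_same_card[OF bij_betw_parent_recursive_trees[OF assms]] by simp
  also have "\<dots> = (\<Prod>i=2..n. i - 1)" by (simp add: card_PiE)
  also have "\<dots> = (\<Prod>i=1..n - 1. i)"
    using assms by (intro prod.reindex_bij_witness[of _ Suc "\<lambda>i. i - 1"]) auto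
  finally show ?thesis by (simp add: fact_prod)
qed

end

theory Submission
  imports Defs
begin

text \<open>
  The depths of the nodes form a Markov chain: given the depths so far, the next node has depth one
  more than that of a uniform earlier node. Hence the mean profile is \<open>a n k = [z^k] (\<Prod>i=1..n. 1 + z/i)\<close>
  for \<open>n + 1\<close> nodes; comparing \<open>(k + 1) * a n (k + 1)\<close> with \<open>harm n * a n k\<close> shows that its mode \<open>m\<close>
  is within \<open>O(1)\<close> of \<open>L\<close>, and that for \<open>\<delta> = |k - L|\<close> the gap \<open>a n m - a n k\<close> is at least of order
  \<open>(n / sqrt L) * min 1 (\<delta>^2 / L)\<close>. The centred difference of the profile at levels \<open>k\<close> and \<open>m\<close> is a
  martingale, whose increments are controlled by second differences of the coefficients of
  \<open>\<Prod>i=j+1..n. 1 + z/i\<close>; these are bounded by Fourier inversion on the unit circle, and all moments of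
  the difference turn out to be \<open>O(|k - m| * n * L^(-3/2))\<close>. So for \<open>\<delta> \<le> L^(2/3)\<close> level \<open>k\<close> beats
  level \<open>m\<close> only with probability \<open>O(\<delta>^(-p))\<close>, which is summed over \<open>\<delta> \<ge> T\<close>. If \<open>T \<ge> L^(2/3)\<close>, a
  maximal level at distance at least \<open>T\<close> would force a proportion \<open>1/(2T + 2)\<close> of all nodes to be that
  far out, and a Chernoff bound for the expected number of such nodes suffices.
\<close>

subsection \<open>Averages over the depth sequence\<close>

abbreviation lsum :: "(nat \<Rightarrow> real) \<Rightarrow> nat list \<Rightarrow> real" where
  "lsum g xs \<equiv> sum_list (map g xs)"

text \<open>Index shift: \<open>depth_avg n f\<close> is the expectation of \<open>f\<close> at the list of depths of the nodes of a
  random recursive tree with \<open>n + 1\<close> nodes.\<close>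

primrec depth_avg :: "nat \<Rightarrow> (nat list \<Rightarrow> real) \<Rightarrow> real" where
  "depth_avg 0 f = f [0]"
| "depth_avg (Suc n) f = depth_avg n (\<lambda>xs. (\<Sum>x\<leftarrow>xs. f (xs @ [Suc x])) / real (Suc n))"

lemma depth_avg_mono:
  assumes "\<And>xs. length xs = Suc n \<Longrightarrow> f xs \<le> g xs"
  shows "depth_avg n f \<le> depth_avg n g"
  using assms
proof (induction n arbitrary: f g)
  case (Suc n)
  show ?case unfolding depth_avg.simps
    by (intro Suc.IH divide_right_mono sum_list_mono Suc.prems) auto
qed simp

lemma depth_avg_cong:
  assumes "\<And>xs. length xs = Suc n \<Longrightarrow> f xs = g xs"
  shows "depth_avg n f = depth_avg n g"
  using assms by (intro antisym depth_avg_mono) auto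

lemma depth_avg_add: "depth_avg n (\<lambda>xs. f xs + g xs) = depth_avg n f + depth_avg n g"
  by (induction n arbitrary: f g) (simp_all add: sum_list_addf add_divide_distrib)

lemma depth_avg_cmult: "depth_avg n (\<lambda>xs. c * f xs) = c * depth_avg n f"
proof (induction n arbitrary: f)
  case (Suc n)
  show ?case unfolding depth_avg.simps Suc.IH[symmetric]
    by (simp add: sum_list_const_mult)
qed simp

lemma depth_avg_diff: "depth_avg n (\<lambda>xs. f xs - g xs) = depth_avg n f - depth_avg n g"
  using depth_avg_add[of n f "\<lambda>xs. (-1) * g xs"] by (simp only: depth_avg_cmult) simp

lemma depth_avg_divide: "depth_avg n (\<lambda>xs. f xs / c) = depth_avg n f / c"
  using depth_avg_cmult[of n "inverse c" f] by (simp add: field_simps)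

lemma depth_avg_const: "depth_avg n (\<lambda>xs. c) = c"
proof (induction n)
  case (Suc n)
  have "depth_avg (Suc n) (\<lambda>xs. c) = depth_avg n (\<lambda>xs. c)"
    unfolding depth_avg.simps by (intro depth_avg_cong) (simp add: sum_list_triv)
  then show ?case using Suc by simp
qed simp

lemma depth_avg_sum: "depth_avg n (\<lambda>xs. \<Sum>i\<in>I. f i xs) = (\<Sum>i\<in>I. depth_avg n (f i))"
  by (induction I rule: infinite_finite_induct)
    (simp_all add: depth_avg_const depth_avg_add)

lemma depth_avg_nonneg:
  assumes "\<And>xs. length xs = Suc n \<Longrightarrow> 0 \<le> f xs"
  shows "0 \<le> depth_avg n f"
  using depth_avg_mono[of n "\<lambda>_. 0" f] assms by (simp add: depth_avg_const)

lemma sum_list_divide: "(\<Sum>x\<leftarrow>xs. g x / c) = (\<Sum>x\<leftarrow>xs. g x) / (c :: real)"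
  by (induction xs) (simp_all add: add_divide_distrib)

text \<open>Every old node keeps its contribution \<open>g d\<close> and is the parent of the new
  node with probability \<open>1 / Suc n\<close>. Linear functionals therefore evolve by a linear
  operator acting on \<open>g\<close> alone.\<close>

lemma depth_avg_Suc_lsum:
  "depth_avg (Suc n) (lsum g) = depth_avg n (lsum (\<lambda>d. g d + g (Suc d) / real (Suc n)))"
  unfolding depth_avg.simps
  by (intro depth_avg_cong)
    (simp add: sum_list_addf sum_list_triv sum_list_divide add_divide_distrib)

text \<open>The hypothesis is the backward recursion that makes \<open>lsum (G j)\<close> a
  martingale along the chain; its mean is the value at the initial list \<open>[0]\<close>.\<close>

lemma depth_avg_lsum_linear:
  assumes "\<And>j d. j < n \<Longrightarrow> G j d = G (Suc j) d + G (Suc j) (Suc d) / real (Suc j)"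
  shows "depth_avg n (lsum (G n)) = G 0 0"
  using assms
proof (induction n)
  case (Suc n)
  have "depth_avg (Suc n) (lsum (G (Suc n))) = depth_avg n (lsum (G n))"
    unfolding depth_avg_Suc_lsum by (simp only: Suc.prems[of n, symmetric] lessI)
  then show ?case using Suc by simp
qed simp

section \<open>From parent functions of recursive trees to depth lists\<close>

primrec depths :: "(nat \<Rightarrow> nat) \<Rightarrow> nat \<Rightarrow> nat list" where
  "depths p 0 = [0]"
| "depths p (Suc n) = depths p n @ [Suc (depths p n ! (p (n + 2) - 1))]"

lemma length_depths [simp]: "length (depths p n) = Suc n"
  by (induction n) auto

lemma depths_cong: "(\<And>i. i \<in> {2..Suc n} \<Longrightarrow> p i = q i) \<Longrightarrow> depths p n = depths q n"
  by (induction n) auto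

text \<open>The node labelled \<open>v\<close> sits at list index \<open>v - 1\<close>, and stage
  \<open>n\<close> holds the labels up to \<open>n + 1\<close>; hence the shifts by one and the
  parent \<open>p (n + 2)\<close> in \<open>depths\<close>.\<close>

lemma nth_depths:
  assumes "2 \<le> v" "v \<le> Suc n" "1 \<le> p v" "p v < v"
  shows "depths p n ! (v - 1) = Suc (depths p n ! (p v - 1))"
  using assms
proof (induction n)
  case (Suc n)
  then show ?case
  proof (cases "v = Suc (Suc n)")
    case True
    then have "p v - 1 < Suc n" using Suc.prems by simp
    then show ?thesis using True by (simp add: nth_append)
  next
    case False
    then have "v - 1 < Suc n" "p v - 1 < Suc n" "v \<le> Suc n" using Suc.prems by auto
    then show ?thesis using Suc by (simp add: nth_append)
  qed
qed simp

text \<open>Each node other than the root has exactly one incoming arc, so all walks from the root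
  to \<open>v\<close> have the same length. The proof establishes this stronger equivalence for
  every \<open>k\<close>, after which \<open>LEAST\<close> has only one candidate.\<close>

lemma root_dist_depths:
  assumes p: "p \<in> (\<Pi>\<^sub>E i\<in>{2..Suc n}. {1..<i})" and v: "v \<in> {1..Suc n}"
  shows "root_dist (1, (\<lambda>i. (p i, i)) ` {2..Suc n}) v = depths p n ! (v - 1)"
proof -
  define E where "E = (\<lambda>i. (p i, i)) ` {2..Suc n}"
  have E: "(u, w) \<in> E \<longleftrightarrow> w \<in> {2..Suc n} \<and> u = p w" for u w
    unfolding E_def by auto
  have pi: "1 \<le> p i" "p i < i" if "i \<in> {2..Suc n}" for i
    using PiE_mem[OF p that] by auto
  have hd0: "depths p n ! 0 = 0"
    by (induction n) (simp_all add: nth_append)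
  have "((1, v) \<in> E ^^ k) \<longleftrightarrow> k = depths p n ! (v - 1)" for k
    using v
  proof (induction v arbitrary: k rule: less_induct)
    case (less v)
    show ?case
    proof (cases "v = 1")
      case True
      have "(1, 1) \<notin> E ^^ Suc j" for j
        using E by (auto simp: relcomp_unfold)
      then show ?thesis using True hd0 by (cases k) auto
    next
      case False
      then have v2: "v \<in> {2..Suc n}" using less.prems by auto
      have "((1, v) \<in> E ^^ k) \<longleftrightarrow> (\<exists>j. k = Suc j \<and> (1, p v) \<in> E ^^ j)"
        using E v2 False by (cases k) (auto simp: relcomp_unfold)
      also have "\<dots> \<longleftrightarrow> (\<exists>j. k = Suc j \<and> j = depths p n ! (p v - 1))"
        using less.IH[of "p v"] pi[OF v2] v2 by auto
      also have "\<dots> \<longleftrightarrow> k = depths p n ! (v - 1)"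
        using nth_depths[of v n p] pi[OF v2] v2 by auto
      finally show ?thesis .
    qed
  qed
  then show ?thesis unfolding root_dist_def E_def[symmetric] prod.case by (metis (lifting) LeastI)
qed

text \<open>The parent of the last node \<open>n + 2\<close> is split off the parent function. Its
  \<open>n + 1\<close> choices match the uniform average in \<open>depth_avg\<close>, so every step
  contributes one factor of the factorial.\<close>

lemma sum_depths:
  "(\<Sum>p\<in>(\<Pi>\<^sub>E i\<in>{2..Suc n}. {1..<i}). f (depths p n)) = fact n * depth_avg n f"
proof (induction n arbitrary: f)
  case (Suc n)
  let ?P = "\<Pi>\<^sub>E i\<in>{2..Suc n}. {1..<i::nat}"
  have ins: "{2..Suc (Suc n)} = insert (n + 2) {2..Suc n}" by auto
  have "(\<Sum>p\<in>(\<Pi>\<^sub>E i\<in>{2..Suc (Suc n)}. {1..<i}). f (depths p (Suc n)))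
      = (\<Sum>(y, p)\<in>{1..<n + 2} \<times> ?P. f (depths (p(n + 2 := y)) (Suc n)))"
    unfolding ins PiE_insert_eq
    by (subst sum.reindex[OF inj_combinator]) (auto simp: case_prod_unfold)
  also have "\<dots> = (\<Sum>(y, p)\<in>{1..<n + 2} \<times> ?P. f (depths p n @ [Suc (depths p n ! (y - 1))]))"
  proof (intro sum.cong refl, clarify)
    fix y and p :: "nat \<Rightarrow> nat"
    have "depths (p(n + 2 := y)) n = depths p n" by (rule depths_cong) auto
    then show "f (depths (p(n + 2 := y)) (Suc n)) = f (depths p n @ [Suc (depths p n ! (y - 1))])"
      by simp
  qed
  also have "\<dots> = (\<Sum>p\<in>?P. \<Sum>y\<in>{1..<n + 2}. f (depths p n @ [Suc (depths p n ! (y - 1))]))"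
    by (subst sum.swap) (simp add: sum.cartesian_product)
  also have "\<dots> = (\<Sum>p\<in>?P. \<Sum>x\<leftarrow>depths p n. f (depths p n @ [Suc x]))"
  proof (intro sum.cong refl)
    fix p :: "nat \<Rightarrow> nat"
    have "(\<Sum>y\<in>{1..<n + 2}. f (depths p n @ [Suc (depths p n ! (y - 1))]))
        = (\<Sum>i = 0..<Suc n. f (depths p n @ [Suc (depths p n ! i)]))"
      by (rule sum.reindex_bij_witness[of _ Suc "\<lambda>i. i - 1"]) auto
    then show "(\<Sum>y\<in>{1..<n + 2}. f (depths p n @ [Suc (depths p n ! (y - 1))]))
        = (\<Sum>x\<leftarrow>depths p n. f (depths p n @ [Suc x]))"
      by (simp add: sum_list_sum_nth)
  qed
  also have "\<dots> = (\<Sum>p\<in>?P. real (Suc n) * (\<lambda>xs. (\<Sum>x\<leftarrow>xs. f (xs @ [Suc x])) / real (Suc n)) (depths p n))"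
    by (simp del: of_nat_Suc)
  also have "\<dots> = real (Suc n) * (fact n * depth_avg n (\<lambda>xs. (\<Sum>x\<leftarrow>xs. f (xs @ [Suc x])) / real (Suc n)))"
    unfolding sum_distrib_left[symmetric] by (rule arg_cong[OF Suc.IH])
  also have "\<dots> = fact (Suc n) * depth_avg (Suc n) f" by simp
  finally show ?case .
qed simp

text \<open>The bridge from trees to depth lists: \<open>f\<close> only has to dominate the
  indicator of \<open>A\<close>, and the tree enters solely through its profile.\<close>

lemma prob_le_depth_avg:
  assumes "\<And>t xs. t \<in> recursive_trees (Suc n) \<Longrightarrow> t \<in> A \<Longrightarrow> length xs = Suc n \<Longrightarrow>
      (\<And>k. real (profile (Suc n) t k) = lsum (\<lambda>d. of_bool (d = k)) xs) \<Longrightarrow> 1 \<le> f xs"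
    and nn: "\<And>xs. length xs = Suc n \<Longrightarrow> 0 \<le> f xs"
  shows "measure_pmf.prob (random_recursive_tree (Suc n)) A \<le> depth_avg n f"
proof -
  let ?R = "recursive_trees (Suc n)" and ?P = "\<Pi>\<^sub>E i\<in>{2..Suc n}. {1..<i::nat}"
  let ?F = "\<lambda>p :: nat \<Rightarrow> nat. (1::nat, (\<lambda>i. (p i, i)) ` {2..Suc n})"
  have bij: "bij_betw ?F ?P ?R" by (rule bij_betw_parent_recursive_trees) simp
  have card: "card ?R = fact n" using card_recursive_trees[of "Suc n"] by simp
  then have fin: "finite ?R" by (metis card.infinite fact_nonzero)
  have ne: "?R \<noteq> {}" using card by (metis card.empty fact_nonzero)
  have "measure_pmf.prob (random_recursive_tree (Suc n)) A = card (?R \<inter> A) / fact n"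
    unfolding random_recursive_tree_def by (simp add: measure_pmf_of_set[OF ne fin] card)
  also have "real (card (?R \<inter> A)) = (\<Sum>t\<in>?R. of_bool (t \<in> A))"
    using fin by (simp add: of_bool_def sum.If_cases Int_def)
  also have "\<dots> = (\<Sum>p\<in>?P. of_bool (?F p \<in> A))"
    by (rule sum.reindex_bij_betw[OF bij, symmetric])
  also have "\<dots> \<le> (\<Sum>p\<in>?P. f (depths p n))"
  proof (rule sum_mono)
    fix p assume p: "p \<in> ?P"
    have prof: "real (profile (Suc n) (?F p) k) = lsum (\<lambda>d. of_bool (d = k)) (depths p n)" for k
    proof -
      have "real (profile (Suc n) (?F p) k) = (\<Sum>v\<in>{1..Suc n}. of_bool (root_dist (?F p) v = k))"
        unfolding profile_def by (subst sum_of_bool_eq) (simp_all add: Int_def)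
      also have "\<dots> = (\<Sum>v\<in>{1..Suc n}. of_bool (depths p n ! (v - 1) = k))"
        by (intro sum.cong refl) (simp only: root_dist_depths[OF p])
      also have "\<dots> = (\<Sum>i = 0..<Suc n. of_bool (depths p n ! i = k))"
        by (rule sum.reindex_bij_witness[of _ Suc "\<lambda>i. i - 1"]) auto
      finally show ?thesis by (simp add: sum_list_sum_nth)
    qed
    show "of_bool (?F p \<in> A) \<le> f (depths p n)"
    proof (cases "?F p \<in> A")
      case True
      then show ?thesis using assms(1)[OF _ True, of "depths p n"] prof bij_betwE[OF bij] p by simp
    qed (use nn in simp)
  qed
  also have "\<dots> = fact n * depth_avg n f" by (rule sum_depths)
  finally show ?thesis by (simp add: divide_le_eq mult.commute divide_right_mono)
qed

subsection \<open>The mean profile\<close>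

definition mean_profile :: "nat \<Rightarrow> nat \<Rightarrow> real" where
  "mean_profile n k = depth_avg n (lsum (\<lambda>d. of_bool (d = k)))"

lemma depth_avg_lsum_add:
  "depth_avg n (lsum (\<lambda>d. g d + h d)) = depth_avg n (lsum g) + depth_avg n (lsum h)"
  by (simp add: sum_list_addf depth_avg_add)

lemma depth_avg_lsum_cmult:
  "depth_avg n (lsum (\<lambda>d. c * g d)) = c * depth_avg n (lsum g)"
  by (simp add: sum_list_const_mult depth_avg_cmult)

lemma mean_profile_0: "mean_profile 0 k = of_bool (k = 0)"
  by (auto simp: mean_profile_def)

lemma mean_profile_Suc_0: "mean_profile (Suc n) 0 = mean_profile n 0"
  unfolding mean_profile_def depth_avg_Suc_lsum by simp

lemma mean_profile_Suc_Suc: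
  "mean_profile (Suc n) (Suc k) = mean_profile n (Suc k) + mean_profile n k / real (Suc n)"
  unfolding mean_profile_def depth_avg_Suc_lsum
  using depth_avg_lsum_add[of n "\<lambda>d. of_bool (d = Suc k)" "\<lambda>d. inverse (real (Suc n)) * of_bool (d = k)"]
    depth_avg_lsum_cmult[of n "inverse (real (Suc n))" "\<lambda>d. of_bool (d = k)"]
  by (simp add: divide_inverse mult.commute)

lemma mean_profile_nonneg: "0 \<le> mean_profile n k"
  unfolding mean_profile_def by (intro depth_avg_nonneg sum_list_nonneg) auto

lemma mean_profile_pos: "k \<le> n \<Longrightarrow> 0 < mean_profile n k"
proof (induction n arbitrary: k)
  case (Suc n)
  then show ?case
    by (cases k) (auto simp: mean_profile_Suc_0 mean_profile_Suc_Suc intro!: add_nonneg_pos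
        mean_profile_nonneg)
qed (simp add: mean_profile_0)

lemma mean_profile_eq_0: "n < k \<Longrightarrow> mean_profile n k = 0"
proof (induction n arbitrary: k)
  case (Suc n)
  then show ?case by (cases k) (auto simp: mean_profile_Suc_Suc)
qed (simp add: mean_profile_0)

text \<open>The elementary symmetric polynomials of \<open>x\<^sub>i = 1/i\<close> satisfy
  \<open>(k + 1) e\<^sub>k\<^sub>+\<^sub>1 \<le> e\<^sub>1 e\<^sub>k\<close>, and the defect is at most \<open>(\<Sum>i. x\<^sub>i\<^sup>2) e\<^sub>k\<^sub>-\<^sub>1\<close>. Together the two bounds locate the mode
  and make the profile decay around it, without any asymptotics of Stirling numbers.\<close>

lemma mean_profile_step_le:
  "real (Suc k) * mean_profile n (Suc k) \<le> harm n * mean_profile n k"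
proof (induction n arbitrary: k)
  case (Suc n)
  define x where "x = inverse (real (Suc n))"
  have x: "x > 0" by (simp add: x_def)
  have hS: "harm (Suc n) = harm n + x" by (simp add: harm_Suc x_def)
  have S: "mean_profile (Suc n) (Suc k) = mean_profile n (Suc k) + x * mean_profile n k" for k
    unfolding mean_profile_Suc_Suc x_def by (simp add: field_simps)
  show ?case
  proof (cases k)
    case 0
    then show ?thesis using Suc.IH[of 0] x
      by (simp add: S mean_profile_Suc_0 hS) (simp add: algebra_simps)
  next
    case (Suc l)
    have "x * (real (Suc l) * mean_profile n (Suc l)) \<le> x * (harm n * mean_profile n l)"
      using Suc.IH x by (intro mult_left_mono) auto
    \<comment> \<open>After the two induction hypotheses, for \<open>Suc l\<close> and for
      \<open>l\<close> scaled by \<open>x\<close>, exactly this second-order term is left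
      over.\<close>
    moreover have "0 \<le> x * (x * mean_profile n l)" using x mean_profile_nonneg by simp
    ultimately show ?thesis using Suc.IH[of "Suc l"] Suc
      by (simp add: S hS) (simp add: algebra_simps)
  qed
qed (simp add: mean_profile_0 harm_def)

lemma mean_profile_1: "mean_profile n 1 = harm n * mean_profile n 0"
  by (induction n)
    (simp_all add: mean_profile_0 harm_def mean_profile_Suc_0 mean_profile_Suc_Suc algebra_simps
      divide_inverse)

lemma mean_profile_step_ge:
  "harm n * mean_profile n (Suc k) - (\<Sum>i=1..n. 1 / real i ^ 2) * mean_profile n k
    \<le> real (k + 2) * mean_profile n (k + 2)"
proof (induction n arbitrary: k)
  case (Suc n)
  define x where "x = inverse (real (Suc n))"
  define P where "P = (\<Sum>i=1..n. 1 / real i ^ 2)"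
  have x: "x > 0" by (simp add: x_def)
  have hS: "harm (Suc n) = harm n + x" by (simp add: harm_Suc x_def)
  have S: "mean_profile (Suc n) (Suc k) = mean_profile n (Suc k) + x * mean_profile n k" for k
    unfolding mean_profile_Suc_Suc x_def by (simp add: field_simps)
  have P': "(\<Sum>i=1..Suc n. 1 / real i ^ 2) = P + x * x"
    unfolding P_def x_def by (simp add: power2_eq_square field_simps)
  show ?case
  proof (cases k)
    case 0
    show ?thesis using Suc.IH[of 0] x unfolding P' P_def[symmetric] 0
      by (simp add: S mean_profile_Suc_0 hS numeral_2_eq_2 mean_profile_1[unfolded One_nat_def] algebra_simps)
  next
    case (Suc l)
    have "x * (harm n * mean_profile n (Suc l) - P * mean_profile n l)
        \<le> x * (real (l + 2) * mean_profile n (l + 2))"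
      using Suc.IH[of l] x unfolding P_def by (intro mult_left_mono) auto
    \<comment> \<open>The growth of the sum of squares by \<open>x * x\<close> cancels all
      second-order terms; what remains is of third order and has the favourable sign.\<close>
    moreover have "0 \<le> x * (x * (x * mean_profile n l))" using x mean_profile_nonneg by simp
    ultimately show ?thesis using Suc.IH[of "Suc l"] unfolding P' P_def[symmetric] Suc
      by (simp add: S hS) (simp add: algebra_simps)
  qed
qed (simp add: mean_profile_0 harm_def)

lemma sum_inverse_squares_le: "(\<Sum>i=1..n. 1 / real i ^ 2) \<le> 2"
proof -
  have "(\<Sum>i=1..Suc n. 1 / real i ^ 2) \<le> 2 - 1 / real (Suc n)"
  proof (induction n)
    case (Suc n)
    have "1 / real (Suc (Suc n)) ^ 2 \<le> 1 / real (Suc n) - 1 / real (Suc (Suc n))"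
      by (simp add: divide_simps power2_eq_square)
    then show ?case using Suc by simp
  qed simp
  then have "(\<Sum>i=1..Suc n. 1 / real i ^ 2) \<le> 2"
    by (smt (verit) divide_nonneg_nonneg of_nat_0_le_iff)
  moreover have "(\<Sum>i=1..n. 1 / real i ^ 2) \<le> (\<Sum>i=1..Suc n. 1 / real i ^ 2)"
    by (intro sum_mono2) auto
  ultimately show ?thesis by linarith
qed

lemma L_ge_1: "1 \<le> L n" by (simp add: L_def)

lemma harm_le_L: "harm n \<le> L (Suc n) + 1"
proof (cases n)
  case (Suc m)
  have "harm (Suc m) - ln (real (Suc m)) \<le> 1"
    using decseqD[OF decseq_harm_diff_ln, of 0 m] by (simp add: harm_def)
  moreover have "ln (real (Suc m)) \<le> ln (real (Suc (Suc m)))" using Suc by simp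
  moreover have "ln (real (Suc (Suc m))) \<le> L (Suc (Suc m))" unfolding L_def by (rule max.cobounded1)
  ultimately show ?thesis unfolding Suc by linarith
qed (simp add: harm_def L_def)

lemma L_le_harm: "L (Suc n) - 1 \<le> harm n"
  using harm_ge_ln[of n] harm_nonneg[of n, where 'a = real] by (simp add: L_def add.commute)

lemma exp_L_le: "exp (L (Suc n)) \<le> exp 1 * (real n + 1)"
proof -
  have "1 \<le> exp 1 * (real n + 1)" using mult_mono[of 1 "exp 1" 1 "real n + 1"] by simp
  moreover have "1 * (real n + 1) \<le> exp 1 * (real n + 1)" by (intro mult_right_mono) auto
  moreover have "exp 1 * 1 \<le> exp 1 * (real n + 1)" by (intro mult_left_mono) auto
  ultimately show ?thesis by (auto simp: L_def max_def add.commute)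
qed

text \<open>Induction on \<open>k\<close>: the previous step shows that the profile has not
  decreased, so the correction in \<open>mean_profile_step_ge\<close> is at most
  \<open>2 * mean_profile n (Suc k)\<close>. Together with \<open>harm n \<ge> L (Suc n) - 1\<close>
  this explains the constant 3.\<close>

lemma mean_profile_increasing:
  assumes "real k + 1 \<le> L (Suc n) - 3"
  shows "(L (Suc n) - 3) * mean_profile n k \<le> (real k + 1) * mean_profile n (Suc k)"
  using assms
proof (induction k)
  case 0
  have "(L (Suc n) - 3) * mean_profile n 0 \<le> harm n * mean_profile n 0"
    using L_le_harm[of n] mean_profile_nonneg by (intro mult_right_mono) auto
  then show ?case using mean_profile_1[of n] by simp
next
  case (Suc k)
  let ?l = "L (Suc n)" and ?a = "mean_profile n"
  have "(?l - 3) * ?a k \<le> (real k + 1) * ?a (Suc k)" using Suc by simp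
  also have "\<dots> \<le> (?l - 3) * ?a (Suc k)"
    using Suc.prems mean_profile_nonneg by (intro mult_right_mono) auto
  finally have "?a k \<le> ?a (Suc k)" using Suc.prems by (simp add: mult_le_cancel_left)
  moreover have "(\<Sum>i=1..n. 1 / real i ^ 2) * ?a k \<le> 2 * ?a k"
    using mean_profile_nonneg by (intro mult_right_mono sum_inverse_squares_le)
  moreover have "(?l - 1) * ?a (Suc k) \<le> harm n * ?a (Suc k)"
    using L_le_harm[of n] mean_profile_nonneg by (intro mult_right_mono)
  ultimately have "(?l - 3) * ?a (Suc k) \<le> real (k + 2) * ?a (k + 2)"
    using mean_profile_step_ge[of n k] by (simp add: algebra_simps)
  then show ?case by (simp add: add.commute)
qed

lemma mean_profile_decreasing:
  "(real k + 1) * mean_profile n (Suc k) \<le> (L (Suc n) + 1) * mean_profile n k"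
proof -
  have "harm n * mean_profile n k \<le> (L (Suc n) + 1) * mean_profile n k"
    using harm_le_L[of n] mean_profile_nonneg by (intro mult_right_mono)
  then show ?thesis using mean_profile_step_le[of k n] by (simp add: add.commute)
qed

lemma geometric_le:
  fixes a :: "nat \<Rightarrow> real"
  assumes "\<And>i. i < r \<Longrightarrow> a (Suc i) \<le> q * a i" "0 \<le> q"
  shows "a r \<le> q ^ r * a 0"
  using assms(1)
proof (induction r)
  case (Suc r)
  have "a (Suc r) \<le> q * a r" using Suc.prems by simp
  also have "\<dots> \<le> q * (q ^ r * a 0)" using Suc assms(2) by (intro mult_left_mono) auto
  finally show ?case by simp
qed simp

text \<open>Walking from \<open>k\<close> towards \<open>L (Suc n)\<close>, each of about
  \<open>d / 2\<close> steps gains a factor \<open>q\<close>, whose exponent is of order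
  \<open>d / l\<close>; the product is Gaussian in \<open>d\<close>.\<close>

lemma mean_profile_gaussian_decay:
  assumes d: "12 \<le> \<bar>real k - L (Suc n)\<bar>" "\<bar>real k - L (Suc n)\<bar> \<le> L (Suc n)"
    and max: "\<And>j. mean_profile n j \<le> M"
  shows "mean_profile n k \<le> exp (- (real k - L (Suc n))\<^sup>2 / (20 * L (Suc n))) * M"
proof -
  let ?a = "mean_profile n"
  define l where "l = L (Suc n)"
  define d where "d = \<bar>real k - l\<bar>"
  \<comment> \<open>Only the outer half of the way is walked, so that the distance to
    \<open>l\<close> stays near \<open>d / 2\<close> or more and one ratio \<open>q\<close> serves
    for all steps.\<close>
  define r where "r = nat \<lfloor>d / 2\<rfloor>"
  define q where "q = exp (- d / (5 * l))"
  have d12: "12 \<le> d" "d \<le> l" using assms by (auto simp: d_def l_def)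
  have r: "real r \<le> d / 2" "d / 4 \<le> real r" using d12 unfolding r_def by linarith+
  have l: "l > 0" using d12 by linarith
  have q0: "0 \<le> q" by (simp add: q_def)
  have qr: "q ^ r \<le> exp (- (real k - l)\<^sup>2 / (20 * l))"
  proof -
    have "d * (d / 4) \<le> d * real r" using r d12 by (intro mult_left_mono) auto
    then have "d\<^sup>2 \<le> 4 * (d * real r)" by (simp add: power2_eq_square)
    then have "d\<^sup>2 / (20 * l) \<le> real r * (d / (5 * l))" using l by (simp add: field_simps)
    moreover have "q ^ r = exp (- (real r * (d / (5 * l))))"
      unfolding q_def by (simp flip: exp_of_nat_mult)
    moreover have "d\<^sup>2 = (real k - l)\<^sup>2" by (simp add: d_def)
    ultimately show ?thesis by simp
  qed
  have "\<exists>j. ?a k \<le> q ^ r * ?a j"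
  proof (cases "l \<le> real k")
    case True
    have kd: "real k = l + d" using True by (simp add: d_def)
    have rk: "r \<le> k" using r kd d12 by linarith
    have "?a (k - r + Suc i) \<le> q * ?a (k - r + i)" if "i < r" for i
    proof -
      have k': "real (k - r + i) + 1 \<ge> l + d / 2 + 1"
        using rk r(1) kd by (simp add: of_nat_diff)
      have "(d / 2) / (l + d / 2 + 1) \<ge> d / (5 * l)"
        using d12 l by (simp add: divide_simps) 
      moreover have "(l + 1) / (l + d / 2 + 1) = 1 - (d / 2) / (l + d / 2 + 1)"
        using d12 l by (simp add: field_simps)
      ultimately have le: "(l + 1) / (l + d / 2 + 1) \<le> q"
        using exp_ge_add_one_self[of "- d / (5 * l)"] unfolding q_def by linarith
      have "(l + d / 2 + 1) * ?a (Suc (k - r + i)) \<le> (real (k - r + i) + 1) * ?a (Suc (k - r + i))"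
        using k' mean_profile_nonneg by (intro mult_right_mono)
      also have "\<dots> \<le> (l + 1) * ?a (k - r + i)"
        unfolding l_def by (rule mean_profile_decreasing)
      finally have "?a (Suc (k - r + i)) \<le> (l + 1) / (l + d / 2 + 1) * ?a (k - r + i)"
        using d12 l by (simp add: pos_le_divide_eq mult.commute)
      also have "\<dots> \<le> q * ?a (k - r + i)" using le mean_profile_nonneg by (intro mult_right_mono)
      finally show ?thesis by simp
    qed
    then have "?a (k - r + r) \<le> q ^ r * ?a (k - r + 0)"
      using q0 by (intro geometric_le[where a = "\<lambda>i. ?a (k - r + i)"])
    then show ?thesis using rk by auto
  next
    case False
    have kd: "real k = l - d" using False by (simp add: d_def)
    have "?a (k + (r - Suc i)) \<le> q * ?a (k + (r - i))" if "i < r" for i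
    proof -
      have si: "Suc (k + (r - Suc i)) = k + (r - i)" using that by simp
      have k': "real (k + (r - Suc i)) + 1 \<le> l - d / 2"
        using that r kd by (simp add: of_nat_diff)
      have "(d / 2 - 3) / (l - 3) \<ge> (d / 4) / l"
        \<comment> \<open>This is where the threshold 12 arises:
          \<open>d / 2 - 3 \<ge> d / 4\<close> is equivalent to \<open>d \<ge> 12\<close>.\<close>
        using d12 l by (intro frac_le) auto
      moreover have "(d / 4) / l \<ge> d / (5 * l)" using d12 l by (simp add: divide_simps)
      moreover have "(l - d / 2) / (l - 3) = 1 - (d / 2 - 3) / (l - 3)"
        using d12 l by (simp add: field_simps)
      ultimately have le: "(l - d / 2) / (l - 3) \<le> q"
        using exp_ge_add_one_self[of "- d / (5 * l)"] unfolding q_def by linarith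
      have "(l - 3) * ?a (k + (r - Suc i)) \<le> (real (k + (r - Suc i)) + 1) * ?a (k + (r - i))"
        using mean_profile_increasing[of "k + (r - Suc i)" n] k' d12 unfolding si l_def by simp
      also have "\<dots> \<le> (l - d / 2) * ?a (k + (r - i))"
        using k' mean_profile_nonneg by (intro mult_right_mono)
      finally have "?a (k + (r - Suc i)) \<le> (l - d / 2) / (l - 3) * ?a (k + (r - i))"
        using d12 l by (simp add: pos_le_divide_eq mult.commute)
      also have "\<dots> \<le> q * ?a (k + (r - i))" using le mean_profile_nonneg by (intro mult_right_mono)
      finally show ?thesis .
    qed
    then have "?a (k + (r - r)) \<le> q ^ r * ?a (k + (r - 0))"
      using q0 by (intro geometric_le[where a = "\<lambda>i. ?a (k + (r - i))"])
    then show ?thesis by auto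
  qed
  then obtain j where "?a k \<le> q ^ r * ?a j" by blast
  also have "\<dots> \<le> exp (- (real k - l)\<^sup>2 / (20 * l)) * M"
    using qr max mean_profile_nonneg by (intro mult_mono) auto
  finally show ?thesis by (simp add: l_def)
qed

text \<open>A maximum exists because the profile vanishes beyond \<open>n\<close>. Comparing it with
  the level just below gives \<open>m \<le> l + 1\<close>, and with the level just above
  \<open>m \<ge> l - 4\<close>.\<close>

lemma mean_profile_mode:
  obtains m where "\<And>j. mean_profile n j \<le> mean_profile n m" "\<bar>real m - L (Suc n)\<bar> \<le> 5"
proof -
  let ?a = "mean_profile n"
  define l where "l = L (Suc n)"
  have "Max (?a ` {..n}) \<in> ?a ` {..n}" by (intro Max_in) auto
  then obtain m where m: "m \<le> n" "?a m = Max (?a ` {..n})" by (metis imageE atMost_iff)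
  have max: "?a j \<le> ?a m" for j
  proof (cases "j \<le> n")
    case True
    then show ?thesis unfolding m(2) by (intro Max_ge) auto
  next
    case False
    then show ?thesis using mean_profile_eq_0[of n j] mean_profile_nonneg by simp
  qed
  have pos: "?a m > 0" using m by (intro mean_profile_pos)
  have "real m \<le> l + 1"
  proof (cases m)
    case 0
    then show ?thesis using L_ge_1[of "Suc n"] by (simp add: l_def)
  next
    case (Suc i)
    have "real m * ?a m \<le> (l + 1) * ?a i"
      using mean_profile_decreasing[of i n] Suc by (simp add: l_def add.commute)
    also have "\<dots> \<le> (l + 1) * ?a m" using max L_ge_1[of "Suc n"] by (intro mult_left_mono) (auto simp: l_def)
    finally show ?thesis using pos by (simp add: mult_le_cancel_right)
  qed
  moreover have "l - 4 \<le> real m"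
  proof (rule ccontr)
    assume c: "\<not> l - 4 \<le> real m"
    have "(l - 3) * ?a m \<le> (real m + 1) * ?a (Suc m)"
      using mean_profile_increasing[of m n] c by (simp add: l_def)
    also have "\<dots> \<le> (real m + 1) * ?a m" using max by (intro mult_left_mono) auto
    finally show False using pos c by (simp add: mult_le_cancel_right)
  qed
  ultimately show ?thesis using max by (intro that[of m]) (auto simp: l_def)
qed

subsection \<open>Chernoff bound and height of the mode\<close>

text \<open>\<open>r ^ d\<close> is an eigenfunction of the operator in
  \<open>depth_avg_Suc_lsum\<close>, with eigenvalue \<open>1 + r / Suc n\<close>.\<close>

lemma depth_avg_lsum_power:
  "depth_avg n (lsum (\<lambda>d. r ^ d)) = (\<Prod>i=1..n. 1 + r / real i)"
proof (induction n)
  case (Suc n)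
  have "depth_avg (Suc n) (lsum (\<lambda>d. r ^ d)) = depth_avg n (lsum (\<lambda>d. (1 + r / real (Suc n)) * r ^ d))"
    unfolding depth_avg_Suc_lsum by (simp add: algebra_simps)
  also have "\<dots> = (1 + r / real (Suc n)) * (\<Prod>i=1..n. 1 + r / real i)"
    unfolding depth_avg_lsum_cmult Suc.IH ..
  finally show ?case by (simp add: mult.commute)
qed simp

lemma depth_avg_lsum_power_le:
  assumes "0 \<le> r"
  shows "depth_avg n (lsum (\<lambda>d. r ^ d)) \<le> exp (r * (L (Suc n) + 1))"
proof -
  have "(\<Prod>i=1..n. 1 + r / real i) \<le> (\<Prod>i=1..n. exp (r / real i))"
    using assms by (intro prod_mono) (auto intro: add_nonneg_nonneg)
  also have "\<dots> = exp (r * harm n)"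
    by (simp add: exp_sum harm_def sum_distrib_left divide_inverse)
  also have "\<dots> \<le> exp (r * (L (Suc n) + 1))"
    using assms harm_le_L[of n] by (simp add: mult_left_mono)
  finally show ?thesis unfolding depth_avg_lsum_power .
qed

lemma depth_avg_lsum_mono:
  assumes "\<And>d. g d \<le> h d"
  shows "depth_avg n (lsum g) \<le> depth_avg n (lsum h)"
  by (intro depth_avg_mono sum_list_mono assms)

text \<open>The indicator is dominated by two exponentials with rates \<open>s\<close> and
  \<open>- s\<close>, and \<open>exp s \<le> 1 + s + s\<^sup>2\<close> leaves the exponent
  \<open>l * s\<^sup>2 - s * t\<close>. Of the constant \<open>exp 4\<close>, three units pay for
  the \<open>+ 1\<close> in \<open>harm n \<le> L (Suc n) + 1\<close> and one for
  \<open>exp_L_le\<close>.\<close>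

lemma depth_tail:
  assumes s: "0 < s" "s \<le> 1"
  shows "depth_avg n (lsum (\<lambda>d. of_bool (t \<le> \<bar>real d - L (Suc n)\<bar>)))
    \<le> 2 * exp 4 * (real n + 1) * exp (L (Suc n) * s\<^sup>2 - s * t)"
proof -
  define l where "l = L (Suc n)"
  have l: "1 \<le> l" unfolding l_def by (rule L_ge_1)
  have es: "exp s \<le> 1 + s + s\<^sup>2" using exp_bound[of s] s by simp
  have ems: "exp (- s) \<le> 1 - s + s\<^sup>2"
  proof -
    \<comment> \<open>The product equals \<open>1 + s ^ 3\<close>.\<close>
    have "1 \<le> (1 + s) * (1 - s + s\<^sup>2)" using s by (simp add: algebra_simps power2_eq_square)
    also have "\<dots> \<le> exp s * (1 - s + s\<^sup>2)"
      using s exp_ge_add_one_self[of s] by (intro mult_right_mono) auto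
    finally show ?thesis by (simp add: exp_minus field_simps)
  qed
  have s2: "s\<^sup>2 \<le> 1" using s by (simp add: power_le_one)
  have "depth_avg n (lsum (\<lambda>d. of_bool (t \<le> \<bar>real d - l\<bar>)))
      \<le> depth_avg n (lsum (\<lambda>d. exp (- s * t - s * l) * exp s ^ d + exp (- s * t + s * l) * exp (- s) ^ d))"
  proof (rule depth_avg_lsum_mono)
    fix d
    have e: "exp (- s * t - s * l) * exp s ^ d = exp (s * ((real d - l) - t))"
      "exp (- s * t + s * l) * exp (- s) ^ d = exp (s * (- (real d - l) - t))"
      by (simp_all add: exp_of_nat_mult[symmetric] exp_add[symmetric] algebra_simps)
    show "of_bool (t \<le> \<bar>real d - l\<bar>)
        \<le> exp (- s * t - s * l) * exp s ^ d + exp (- s * t + s * l) * exp (- s) ^ d"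
    proof (cases "t \<le> \<bar>real d - l\<bar>")
      case True
      then have "0 \<le> s * ((real d - l) - t) \<or> 0 \<le> s * (- (real d - l) - t)"
        using s by (auto simp: abs_if zero_le_mult_iff split: if_splits)
      then have "1 \<le> exp (s * ((real d - l) - t)) \<or> 1 \<le> exp (s * (- (real d - l) - t))" by simp
      then show ?thesis unfolding e using True
        by (smt (verit) exp_gt_zero of_bool_eq(2))
    qed (simp add: add_nonneg_nonneg)
  qed
  also have "\<dots> = exp (- s * t - s * l) * depth_avg n (lsum (\<lambda>d. exp s ^ d))
      + exp (- s * t + s * l) * depth_avg n (lsum (\<lambda>d. exp (- s) ^ d))"
    by (simp only: depth_avg_lsum_add depth_avg_lsum_cmult)
  also have "\<dots> \<le> exp (- s * t - s * l) * exp (exp s * (l + 1))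
      + exp (- s * t + s * l) * exp (exp (- s) * (l + 1))"
    unfolding l_def by (intro add_mono mult_left_mono depth_avg_lsum_power_le) auto
  also have "\<dots> \<le> exp (3 + (l * s\<^sup>2 - s * t)) * exp l + exp (3 + (l * s\<^sup>2 - s * t)) * exp l"
  proof (intro add_mono)
    have "exp s * (l + 1) \<le> (1 + s + s\<^sup>2) * (l + 1)" using es l by (intro mult_right_mono) auto
    then have "- s * t - s * l + exp s * (l + 1) \<le> 3 + (l * s\<^sup>2 - s * t) + l"
      using s s2 by (simp add: algebra_simps)
    then show "exp (- s * t - s * l) * exp (exp s * (l + 1)) \<le> exp (3 + (l * s\<^sup>2 - s * t)) * exp l"
      unfolding exp_add[symmetric] by simp
    have "exp (- s) * (l + 1) \<le> (1 - s + s\<^sup>2) * (l + 1)" using ems l by (intro mult_right_mono) auto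
    then have "- s * t + s * l + exp (- s) * (l + 1) \<le> 3 + (l * s\<^sup>2 - s * t) + l"
      using s s2 by (simp add: algebra_simps)
    then show "exp (- s * t + s * l) * exp (exp (- s) * (l + 1)) \<le> exp (3 + (l * s\<^sup>2 - s * t)) * exp l"
      unfolding exp_add[symmetric] by simp
  qed
  also have "\<dots> = 2 * exp 3 * exp (l * s\<^sup>2 - s * t) * exp l" by (simp add: exp_add)
  also have "\<dots> \<le> 2 * exp 3 * exp (l * s\<^sup>2 - s * t) * (exp 1 * (real n + 1))"
    unfolding l_def by (intro mult_left_mono exp_L_le) auto
  also have "\<dots> = 2 * exp (3 + 1) * (real n + 1) * exp (l * s\<^sup>2 - s * t)"
    unfolding exp_add by simp
  finally show ?thesis by (simp add: l_def)
qed

lemma near_levels: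
  assumes "0 \<le> t"
  shows "finite {k :: nat. \<bar>real k - l\<bar> < t}" "real (card {k :: nat. \<bar>real k - l\<bar> < t}) \<le> 2 * t + 1"
proof -
  have sub: "int ` {k :: nat. \<bar>real k - l\<bar> < t} \<subseteq> {\<lceil>l - t\<rceil>..\<lfloor>l + t\<rfloor>}"
    by (auto simp: le_floor_iff ceiling_le_iff)
  then have "finite (int ` {k :: nat. \<bar>real k - l\<bar> < t})" by (rule finite_subset) simp
  then show fin: "finite {k :: nat. \<bar>real k - l\<bar> < t}"
    by (rule finite_imageD) simp
  have "card {k :: nat. \<bar>real k - l\<bar> < t} = card (int ` {k :: nat. \<bar>real k - l\<bar> < t})"
    by (simp add: card_image)
  also have "\<dots> \<le> card {\<lceil>l - t\<rceil>..\<lfloor>l + t\<rfloor>}" using sub by (intro card_mono) auto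
  also have "\<dots> = nat (\<lfloor>l + t\<rfloor> + 1 - \<lceil>l - t\<rceil>)" by simp
  finally show "real (card {k :: nat. \<bar>real k - l\<bar> < t}) \<le> 2 * t + 1"
    using assms by linarith
qed

text \<open>The counting behind two pigeonhole arguments: the lower bound for the mode, and the tail
  of very distant maximal levels.\<close>

lemma count_near_or_far:
  "real (length xs) \<le> lsum (\<lambda>d. of_bool (t \<le> \<bar>real d - l\<bar>)) xs
      + (\<Sum>k\<in>{k :: nat. \<bar>real k - l\<bar> < t}. lsum (\<lambda>d. of_bool (d = k)) xs)"
proof (cases "0 \<le> t")
  case True
  then have fin: "finite {k :: nat. \<bar>real k - l\<bar> < t}" by (rule near_levels)
  show ?thesis
  proof (induction xs)
    case (Cons x xs)
    have "1 \<le> of_bool (t \<le> \<bar>real x - l\<bar>) + (\<Sum>k\<in>{k :: nat. \<bar>real k - l\<bar> < t}. of_bool (x = k) :: real)"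
      using fin by (auto simp: of_bool_def)
    then show ?case using Cons by (simp add: sum.distrib)
  qed simp
next
  case False
  then have "{k :: nat. \<bar>real k - l\<bar> < t} = {}" "\<And>d. t \<le> \<bar>real d - l\<bar>" by auto
  then show ?thesis by (simp add: sum_list_triv)
qed

text \<open>On average at least half of the nodes lie within \<open>8 * sqrt l\<close> of
  \<open>l\<close>, and at most \<open>17 * sqrt l\<close> levels share them.\<close>

lemma mean_profile_max_ge:
  assumes max: "\<And>j. mean_profile n j \<le> M"
  shows "(real n + 1) / (34 * sqrt (L (Suc n))) \<le> M"
proof -
  define l where "l = L (Suc n)"
  have l: "1 \<le> l" unfolding l_def by (rule L_ge_1)
  \<comment> \<open>With these \<open>s\<close> and \<open>t\<close> the Chernoff exponent is
    \<open>1 - 8 = - 7\<close>, which beats \<open>2 * exp 4\<close> and leaves less than half of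
    the nodes far away.\<close>
  define s where "s = 1 / sqrt l"
  define t where "t = 8 * sqrt l"
  have s: "0 < s" "s \<le> 1" using l by (auto simp: s_def)
  have M: "0 \<le> M" using max[of 0] mean_profile_nonneg[of n 0] by linarith
  let ?K = "{k :: nat. \<bar>real k - l\<bar> < t}" and ?far = "\<lambda>d. of_bool (t \<le> \<bar>real d - l\<bar>)"
  have t: "0 \<le> t" using l by (simp add: t_def)
  have "real n + 1 = depth_avg n (\<lambda>xs. real (length xs))"
    using depth_avg_cong[of n "\<lambda>xs. real (length xs)" "\<lambda>xs. real n + 1"]
    by (simp add: depth_avg_const)
  also have "\<dots> \<le> depth_avg n (\<lambda>xs. lsum ?far xs + (\<Sum>k\<in>?K. lsum (\<lambda>d. of_bool (d = k)) xs))"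
    by (intro depth_avg_mono count_near_or_far)
  also have "\<dots> = depth_avg n (lsum ?far) + (\<Sum>k\<in>?K. mean_profile n k)"
    unfolding mean_profile_def depth_avg_add depth_avg_sum ..
  also have "depth_avg n (lsum ?far) \<le> 2 * exp 4 * (real n + 1) * exp (l * s\<^sup>2 - s * t)"
    unfolding l_def using s by (rule depth_tail)
  also have "l * s\<^sup>2 - s * t = - 7" using l by (simp add: s_def t_def power_divide)
  also have "2 * exp 4 * (real n + 1) * exp (- 7) = 2 * (real n + 1) * exp (- 3)"
    using exp_add[of 4 "- 7 :: real"] by simp
  also have "2 * (real n + 1) * exp (- 3) \<le> 2 * (real n + 1) * (1 / 4)"
    using exp_ge_add_one_self[of 3] by (intro mult_left_mono) (auto simp: exp_minus divide_simps)
  also have "(\<Sum>k\<in>?K. mean_profile n k) \<le> (\<Sum>k\<in>?K. M)" by (intro sum_mono max)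
  also have "\<dots> = real (card ?K) * M" by simp
  also have "\<dots> \<le> (2 * t + 1) * M" using near_levels(2)[OF t] M by (intro mult_right_mono)
  also have "\<dots> \<le> 17 * sqrt l * M" using M l by (intro mult_right_mono) (auto simp: t_def)
  finally have "real n + 1 \<le> M * (34 * sqrt l)" by (simp add: algebra_simps)
  then show ?thesis using l unfolding l_def[symmetric] by (simp add: pos_divide_le_eq)
qed

section \<open>Power inequalities for the even moments\<close>

lemma power_mult_le_sum_powers:
  fixes x y :: real
  assumes "0 \<le> x" "0 \<le> y"
  shows "x ^ i * y ^ j \<le> x ^ (i + j) + y ^ (i + j)"
proof (cases "x \<le> y")
  case True
  then have "x ^ i * y ^ j \<le> y ^ i * y ^ j" using assms by (intro mult_right_mono power_mono) auto
  then show ?thesis using assms by (simp add: power_add add_increasing)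
next
  case False
  then have "x ^ i * y ^ j \<le> x ^ i * x ^ j" using assms by (intro mult_left_mono power_mono) auto
  then show ?thesis using assms by (simp add: power_add add_increasing2)
qed

text \<open>The first-order term is kept exactly because it averages to zero over a martingale
  increment. All higher terms share one bound, and their binomial coefficients add up to at most
  \<open>2 ^ (2 * p) = 4 ^ p\<close>.\<close>

lemma power_add_le_even:
  fixes x y :: real
  assumes "1 \<le> p"
  shows "(x + y) ^ (2 * p) \<le> x ^ (2 * p) + 2 * real p * x ^ (2 * p - 1) * y
    + 4 ^ p * (x ^ (2 * p - 2) * y\<^sup>2 + y ^ (2 * p))"
proof -
  let ?B = "x ^ (2 * p - 2) * y\<^sup>2 + y ^ (2 * p)"
  obtain q where q: "2 * p = Suc (Suc q)" using assms by (cases p) auto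
  have qr: "2 * real p = real q + 2" using q by linarith
  have eq: "even q" using q by presburger
  have B: "0 \<le> ?B" using eq q by (auto intro!: add_nonneg_nonneg zero_le_even_power simp del: power_Suc)
  have t: "\<bar>x\<bar> ^ i * \<bar>y\<bar> ^ (j + 2) \<le> ?B" if "i + j = q" for i j
  proof -
    have "\<bar>x\<bar> ^ i * \<bar>y\<bar> ^ (j + 2) = \<bar>x\<bar> ^ i * \<bar>y\<bar> ^ j * y\<^sup>2"
      by (simp add: power_add power2_eq_square)
    also have "\<dots> \<le> (\<bar>x\<bar> ^ q + \<bar>y\<bar> ^ q) * y\<^sup>2"
      using power_mult_le_sum_powers[of "\<bar>x\<bar>" "\<bar>y\<bar>" i j] that by (intro mult_right_mono) auto
    also have "\<dots> = ?B" using eq q by (simp add: power_even_abs algebra_simps power2_eq_square)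
    finally show ?thesis .
  qed
  have "(x + y) ^ (2 * p) = (y + x) ^ (2 * p)" by (simp add: add.commute)
  also have "\<dots> = (\<Sum>k\<le>2 * p. real (2 * p choose k) * y ^ k * x ^ (2 * p - k))"
    by (rule binomial_ring)
  also have "\<dots> = x ^ (2 * p) + 2 * real p * x ^ (2 * p - 1) * y
      + (\<Sum>k\<le>q. real (2 * p choose (k + 2)) * y ^ (k + 2) * x ^ (q - k))"
    unfolding qr unfolding q
    by (subst sum.atMost_Suc_shift, subst sum.atMost_Suc_shift) (simp add: algebra_simps)
  also have "(\<Sum>k\<le>q. real (2 * p choose (k + 2)) * y ^ (k + 2) * x ^ (q - k))
      \<le> (\<Sum>k\<le>q. real (2 * p choose (k + 2)) * ?B)"
  proof (rule sum_mono)
    fix k assume k: "k \<in> {..q}"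
    have "y ^ (k + 2) * x ^ (q - k) \<le> \<bar>y ^ (k + 2) * x ^ (q - k)\<bar>" by (rule abs_ge_self)
    also have "\<dots> = \<bar>x\<bar> ^ (q - k) * \<bar>y\<bar> ^ (k + 2)" by (simp add: abs_mult power_abs mult.commute)
    also have "\<dots> \<le> ?B" using k by (intro t) auto
    finally have "real (2 * p choose (k + 2)) * (y ^ (k + 2) * x ^ (q - k)) \<le> real (2 * p choose (k + 2)) * ?B"
      by (intro mult_left_mono) auto
    then show "real (2 * p choose (k + 2)) * y ^ (k + 2) * x ^ (q - k) \<le> real (2 * p choose (k + 2)) * ?B"
      by (simp only: mult.assoc)
  qed
  also have "\<dots> = real (\<Sum>k\<le>q. 2 * p choose (k + 2)) * ?B" by (simp add: sum_distrib_right)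
  also have "(\<Sum>k\<le>q. 2 * p choose (k + 2)) \<le> (\<Sum>k\<le>2 * p. 2 * p choose k)"
    unfolding q by (simp add: sum.atMost_Suc_shift del: sum.atMost_Suc binomial_Suc_Suc)
  also have "\<dots> = 4 ^ p" by (simp add: choose_row_sum power_mult)
  finally show ?thesis using B by (simp add: mult_right_mono)
qed

subsection \<open>Moments of linear functionals of the profile\<close>

lemma prod_three_halves_le: "(\<Prod>i=1..n. 1 + (3 / 2) / real i) \<le> (real n + 1) * sqrt (real n + 1)"
proof (induction n)
  case (Suc n)
  define m where "m = real n + 1"
  have m: "m \<ge> 1" by (simp add: m_def)
  have "(\<Prod>i=1..Suc n. 1 + (3 / 2) / real i) \<le> (m * sqrt m) * (1 + (3 / 2) / m)"
    using Suc m by (simp add: m_def add.commute mult_right_mono)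
  also have "\<dots> = (m + 3 / 2) * sqrt m" using m by (simp add: field_simps)
  also have "\<dots> = sqrt ((m + 3 / 2)\<^sup>2 * m)" using m by (simp add: real_sqrt_mult)
  also have "\<dots> \<le> sqrt ((m + 1)\<^sup>2 * (m + 1))"
    \<comment> \<open>Both sides begin with \<open>m ^ 3 + 3 * m\<^sup>2\<close>; then
      \<open>9 / 4 * m\<close> is compared with \<open>3 * m + 1\<close>.\<close>
    using m by (intro real_sqrt_le_mono) (simp add: power2_eq_square algebra_simps)
  also have "\<dots> = (m + 1) * sqrt (m + 1)" using m by (simp add: real_sqrt_mult)
  finally show ?case by (simp add: m_def add.commute)
qed simp

text \<open>The power is dominated by a multiple of \<open>(3 / 2) ^ d\<close>, whose mean sum is an
  explicit product. The surplus factor \<open>sqrt (real n + 1)\<close> is affordable: the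
  increments in \<open>profile_fluctuation\<close> stay summable.\<close>

lemma depth_moment:
  assumes "1 \<le> q"
  shows "\<exists>C>0. \<forall>n. depth_avg n (lsum (\<lambda>d. real d ^ q)) \<le> C * ((real n + 1) * sqrt (real n + 1))"
proof -
  define C where "C = (real q / ln (3 / 2)) ^ q"
  have C: "C > 0" using assms by (simp add: C_def)
  have "real d ^ q \<le> C * (3 / 2) ^ d" for d
  proof -
    have "(real d * ln (3 / 2) / real q) ^ q \<le> (1 + real d * ln (3 / 2) / real q) ^ q"
      by (intro power_mono) auto
    also have "\<dots> \<le> exp (real d * ln (3 / 2))"
      using assms by (intro exp_ge_one_plus_x_over_n_power_n) (auto intro: order_trans[of _ 0])
    also have "\<dots> = (3 / 2) ^ d" by (simp add: exp_of_nat_mult)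
    finally have "C * (real d * ln (3 / 2) / real q) ^ q \<le> C * (3 / 2) ^ d"
      using C by (intro mult_left_mono) auto
    moreover have "C * (real d * ln (3 / 2) / real q) ^ q = real d ^ q"
      unfolding C_def power_mult_distrib[symmetric] using assms by simp
    ultimately show ?thesis by simp
  qed
  then have "depth_avg n (lsum (\<lambda>d. real d ^ q)) \<le> depth_avg n (lsum (\<lambda>d. C * (3 / 2) ^ d))" for n
    by (intro depth_avg_lsum_mono)
  also have "depth_avg n (lsum (\<lambda>d. C * (3 / 2) ^ d)) \<le> C * ((real n + 1) * sqrt (real n + 1))" for n
    unfolding depth_avg_lsum_cmult depth_avg_lsum_power
    using C prod_three_halves_le by (intro mult_left_mono) auto
  finally show ?thesis using C by blast
qed

lemma mean_even_power_le:
  fixes f :: "'a \<Rightarrow> real"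
  assumes "even p" "xs \<noteq> []"
  shows "((\<Sum>x\<leftarrow>xs. f x) / real (length xs)) ^ p \<le> (\<Sum>x\<leftarrow>xs. f x ^ p) / real (length xs)"
proof -
  have "(\<Sum>i\<in>{0..<length xs}. (1 / real (length xs)) *\<^sub>R f (xs ! i)) ^ p
      \<le> (\<Sum>i\<in>{0..<length xs}. (1 / real (length xs)) * f (xs ! i) ^ p)"
    using assms
    by (intro convex_on_sum[where C = UNIV and f = "\<lambda>x. x ^ p"] convex_power_even) auto
  then show ?thesis by (simp add: sum_list_sum_nth sum_divide_distrib)
qed

text \<open>Young's inequality splits the mixed term \<open>Q ^ (2 * p - 2) * D\<^sup>2\<close>, with the variance proxy \<open>A\<close> of the
  whole martingale as normalization: the factor in front of \<open>Q ^ (2 * p)\<close> is then summable over the steps.\<close>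

lemma moment_step_pointwise:
  fixes Q D R A b m :: real
  assumes p: "1 \<le> p" and m: "1 \<le> m" and A: "0 < A" "b\<^sup>2 * sqrt m \<le> A" and D: "\<bar>D\<bar> \<le> b * R"
  shows "(Q + D) ^ (2 * p) \<le> Q ^ (2 * p) + 2 * real p * Q ^ (2 * p - 1) * D
    + 4 ^ p * (b\<^sup>2 * sqrt m / A) * (Q ^ (2 * p) + 2 * A ^ p * R ^ (2 * p) / sqrt m)"
proof -
  define w where "w = b\<^sup>2 * sqrt m / A"
  define Z where "Z = A * R\<^sup>2 / sqrt m"
  have w: "0 \<le> w" "w \<le> 1" using A m by (auto simp: w_def divide_le_eq)
  have Z: "0 \<le> Z" using A m by (simp add: Z_def)
  have "D\<^sup>2 \<le> (b * R)\<^sup>2" using D by (metis abs_ge_zero abs_power2 power2_abs power_mono)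
  also have "\<dots> = w * Z" using A m by (simp add: w_def Z_def power_mult_distrib)
  finally have D2: "D\<^sup>2 \<le> w * Z" .
  have "Q ^ (2 * p - 2) * D\<^sup>2 \<le> (Q\<^sup>2) ^ (p - 1) * (w * Z)"
  proof -
    have "Q ^ (2 * p - 2) = (Q\<^sup>2) ^ (p - 1)" by (simp add: power_mult[symmetric] diff_mult_distrib2)
    then show ?thesis using D2 by (simp add: mult_left_mono)
  qed
  also have "\<dots> = w * ((Q\<^sup>2) ^ (p - 1) * Z ^ 1)" by simp
  also have "\<dots> \<le> w * ((Q\<^sup>2) ^ (p - 1 + 1) + Z ^ (p - 1 + 1))"
    using w Z by (intro mult_left_mono power_mult_le_sum_powers) auto
  also have "\<dots> = w * (Q ^ (2 * p) + Z ^ p)" using p by (simp add: power_mult)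
  finally have t1: "Q ^ (2 * p - 2) * D\<^sup>2 \<le> w * (Q ^ (2 * p) + Z ^ p)" .
  have "D ^ (2 * p) = (D\<^sup>2) ^ p" by (simp add: power_mult)
  also have "\<dots> \<le> (w * Z) ^ p" using D2 by (intro power_mono) auto
  also have "\<dots> = w ^ p * Z ^ p" by (rule power_mult_distrib)
  also have "\<dots> \<le> w * Z ^ p"
    using w Z p power_decreasing[of 1 p w] by (intro mult_right_mono) auto
  finally have t2: "D ^ (2 * p) \<le> w * Z ^ p" .
  have "Z ^ p = A ^ p * R ^ (2 * p) / sqrt m ^ p"
    by (simp add: Z_def power_divide power_mult_distrib power_mult)
  also have "\<dots> \<le> A ^ p * R ^ (2 * p) / sqrt m"
    \<comment> \<open>A single factor \<open>sqrt m\<close> suffices in the denominator, since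
      \<open>depth_moment\<close> loses only one.\<close>
    using m A p self_le_power[of "sqrt m" p] by (intro divide_left_mono) auto
  finally have t3: "Z ^ p \<le> A ^ p * R ^ (2 * p) / sqrt m" .
  have "Q ^ (2 * p - 2) * D\<^sup>2 + D ^ (2 * p) \<le> w * (Q ^ (2 * p) + 2 * Z ^ p)"
    using t1 t2 by (simp add: algebra_simps)
  also have "\<dots> \<le> w * (Q ^ (2 * p) + 2 * A ^ p * R ^ (2 * p) / sqrt m)"
    using t3 w by (intro mult_left_mono) auto
  finally have "4 ^ p * (Q ^ (2 * p - 2) * D\<^sup>2 + D ^ (2 * p))
      \<le> 4 ^ p * (w * (Q ^ (2 * p) + 2 * A ^ p * R ^ (2 * p) / sqrt m))"
    by (intro mult_left_mono) auto
  then show ?thesis using power_add_le_even[OF p, of Q D] by (simp add: w_def mult.assoc)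
qed

text \<open>One step of the chain with a uniform parent \<open>x\<close>: the increment
  \<open>D x\<close> is centred, so its linear contribution sums to zero, and the Lipschitz bound
  reduces its size to mean distances between depths, hence to depth moments.\<close>

lemma moment_step:
  fixes g :: "nat \<Rightarrow> real" and xs :: "nat list"
  defines "m \<equiv> real (length xs)"
  assumes p: "1 \<le> p" and ne: "xs \<noteq> []" and A: "0 < A" "b\<^sup>2 * sqrt m \<le> A"
    and lip: "\<And>d e. \<bar>g d - g e\<bar> \<le> b * \<bar>real d - real e\<bar>"
  shows "(\<Sum>x\<leftarrow>xs. (Q + (g x - lsum g xs / m)) ^ (2 * p)) / m \<le> Q ^ (2 * p)
    + 4 ^ p * (b\<^sup>2 * sqrt m / A) * (Q ^ (2 * p) + 4 * A ^ p * (lsum (\<lambda>d. real d ^ (2 * p)) xs / m) / sqrt m)"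
proof -
  define R where "R = (\<lambda>x. (\<Sum>v\<leftarrow>xs. \<bar>real x - real v\<bar>) / m)"
  define D where "D = (\<lambda>x. g x - lsum g xs / m)"
  define w where "w = 4 ^ p * (b\<^sup>2 * sqrt m / A)"
  define M where "M = lsum (\<lambda>d. real d ^ (2 * p)) xs / m"
  have m: "1 \<le> m" using ne by (cases xs) (auto simp: m_def)
  have w: "0 \<le> w" using A m by (simp add: w_def)
  have D: "\<bar>D x\<bar> \<le> b * R x" for x
  proof -
    have "D x = (\<Sum>v\<leftarrow>xs. g x - g v) / m"
      using m by (simp add: D_def sum_list_subtractf sum_list_triv m_def[symmetric] field_simps)
    also have "\<bar>\<dots>\<bar> \<le> (\<Sum>v\<leftarrow>xs. \<bar>g x - g v\<bar>) / m"
      using m sum_list_abs[of "map (\<lambda>v. g x - g v) xs"] by (simp add: abs_divide divide_right_mono comp_def)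
    also have "\<dots> \<le> (\<Sum>v\<leftarrow>xs. b * \<bar>real x - real v\<bar>) / m"
      using m lip by (intro divide_right_mono sum_list_mono) auto
    finally show ?thesis by (simp add: R_def sum_list_const_mult)
  qed
  have D0: "lsum D xs = 0"
    using m by (simp add: D_def sum_list_subtractf sum_list_triv m_def[symmetric])
  have R: "R x ^ (2 * p) \<le> real x ^ (2 * p) + M" for x
  proof -
    have "R x ^ (2 * p) \<le> (\<Sum>v\<leftarrow>xs. \<bar>real x - real v\<bar> ^ (2 * p)) / m"
      unfolding R_def m_def using ne by (intro mean_even_power_le) auto
    also have "\<dots> \<le> (\<Sum>v\<leftarrow>xs. real x ^ (2 * p) + real v ^ (2 * p)) / m"
    proof (intro divide_right_mono sum_list_mono)
      fix v :: nat
      have "\<bar>real x - real v\<bar> ^ (2 * p) \<le> max (real x) (real v) ^ (2 * p)"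
        by (intro power_mono) auto
      then show "\<bar>real x - real v\<bar> ^ (2 * p) \<le> real x ^ (2 * p) + real v ^ (2 * p)"
        by (smt (verit) max_def of_nat_0_le_iff zero_le_power)
    qed (use m in auto)
    also have "\<dots> = real x ^ (2 * p) + M"
      using m by (simp add: M_def sum_list_addf sum_list_triv m_def[symmetric] add_divide_distrib)
    finally show ?thesis .
  qed
  have "(\<Sum>x\<leftarrow>xs. (Q + D x) ^ (2 * p)) \<le> (\<Sum>x\<leftarrow>xs. Q ^ (2 * p) + 2 * real p * Q ^ (2 * p - 1) * D x
      + w * (Q ^ (2 * p) + 2 * A ^ p * (real x ^ (2 * p) + M) / sqrt m))"
  proof (rule sum_list_mono)
    fix x
    have "(Q + D x) ^ (2 * p) \<le> Q ^ (2 * p) + 2 * real p * Q ^ (2 * p - 1) * D x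
        + w * (Q ^ (2 * p) + 2 * A ^ p * R x ^ (2 * p) / sqrt m)"
      unfolding w_def by (rule moment_step_pointwise[OF p m A D])
    also have "\<dots> \<le> Q ^ (2 * p) + 2 * real p * Q ^ (2 * p - 1) * D x
        + w * (Q ^ (2 * p) + 2 * A ^ p * (real x ^ (2 * p) + M) / sqrt m)"
      using w m A R[of x] by (intro add_left_mono mult_left_mono divide_right_mono) auto
    finally show "(Q + D x) ^ (2 * p) \<le> Q ^ (2 * p) + 2 * real p * Q ^ (2 * p - 1) * D x
        + w * (Q ^ (2 * p) + 2 * A ^ p * (real x ^ (2 * p) + M) / sqrt m)" .
  qed
  also have "\<dots> = m * Q ^ (2 * p) + 2 * real p * Q ^ (2 * p - 1) * lsum D xs
      + w * (m * Q ^ (2 * p) + 2 * A ^ p * (m * M + m * M) / sqrt m)"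
    using m
    by (simp add: sum_list_addf sum_list_triv sum_list_const_mult sum_list_divide distrib_left
        m_def[symmetric] add_divide_distrib) (simp add: M_def)
  also have "\<dots> = m * (Q ^ (2 * p) + w * (Q ^ (2 * p) + 4 * A ^ p * M / sqrt m))"
    unfolding D0 by (simp add: algebra_simps)
  finally show ?thesis
    using m unfolding D_def w_def M_def by (simp add: pos_divide_le_eq mult.commute)
qed

text \<open>A moment inequality for the martingale \<open>lsum (G j)\<close>, with
  \<open>b j\<close> a Lipschitz constant for step \<open>j\<close> and \<open>A\<close> a bound for
  the total variance proxy. The steps are combined by a discrete Gronwall argument.\<close>

lemma profile_moment:
  assumes p: "1 \<le> p"
  obtains C :: real where "C > 0"
    and "\<And>n G b A. (\<And>j d. j < n \<Longrightarrow> G j d = G (Suc j) d + G (Suc j) (Suc d) / real (Suc j)) \<Longrightarrow>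
      (\<And>j d e. j < n \<Longrightarrow> \<bar>G (Suc j) d - G (Suc j) e\<bar> \<le> b j * \<bar>real d - real e\<bar>) \<Longrightarrow>
      0 < A \<Longrightarrow> (\<Sum>j<n. (b j)\<^sup>2 * sqrt (real (Suc j))) \<le> A \<Longrightarrow>
      depth_avg n (\<lambda>xs. (lsum (G n) xs - G 0 0) ^ (2 * p)) \<le> C * A ^ p"
proof -
  obtain C where C: "C > 0" "\<And>n. depth_avg n (lsum (\<lambda>d. real d ^ (2 * p))) \<le> C * ((real n + 1) * sqrt (real n + 1))"
    using depth_moment[of "2 * p"] p by auto
  define K :: real where "K = 4 ^ p"
  have K: "0 < K" by (simp add: K_def)
  have main: "depth_avg n (\<lambda>xs. (lsum (G n) xs - G 0 0) ^ (2 * p)) \<le> exp K * (4 * C) * A ^ p"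
    if rec: "\<And>j d. j < n \<Longrightarrow> G j d = G (Suc j) d + G (Suc j) (Suc d) / real (Suc j)"
      and lip: "\<And>j d e. j < n \<Longrightarrow> \<bar>G (Suc j) d - G (Suc j) e\<bar> \<le> b j * \<bar>real d - real e\<bar>"
      and A: "0 < A" and sum: "(\<Sum>j<n. (b j)\<^sup>2 * sqrt (real (Suc j))) \<le> A"
    for n and G :: "nat \<Rightarrow> nat \<Rightarrow> real" and b :: "nat \<Rightarrow> real" and A :: real
  proof -
    define X where "X = (\<lambda>j. depth_avg j (\<lambda>xs. (lsum (G j) xs - G 0 0) ^ (2 * p)))"
    define w where "w = (\<lambda>j. (b j)\<^sup>2 * sqrt (real (Suc j)) / A)"
    define Y where "Y = 4 * C * A ^ p"
    have Y: "0 \<le> Y" using C A by (simp add: Y_def)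
    have X: "0 \<le> X j" for j
      unfolding X_def by (intro depth_avg_nonneg) (simp add: power_mult)
    have w0: "0 \<le> w j" for j using A by (simp add: w_def)
    have step: "X (Suc j) \<le> X j + K * w j * (X j + Y)" if j: "j < n" for j
    proof -
      define m where "m = real (Suc j)"
      have m: "1 \<le> m" by (simp add: m_def)
      have bj: "(b j)\<^sup>2 * sqrt m \<le> A"
        using member_le_sum[of j "{..<n}" "\<lambda>j. (b j)\<^sup>2 * sqrt (real (Suc j))"] j sum
        by (simp add: m_def del: of_nat_Suc)
      let ?M = "\<lambda>xs. lsum (\<lambda>d. real d ^ (2 * p)) xs" and ?Q = "\<lambda>xs. lsum (G j) xs - G 0 0"
      have "X (Suc j) = depth_avg j (\<lambda>xs. (\<Sum>x\<leftarrow>xs. (lsum (G (Suc j)) (xs @ [Suc x]) - G 0 0) ^ (2 * p)) / m)"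
        by (simp add: X_def m_def)
      also have "\<dots> \<le> depth_avg j (\<lambda>xs. ?Q xs ^ (2 * p) + K * w j * (?Q xs ^ (2 * p) + 4 * A ^ p * (?M xs / m) / sqrt m))"
      proof (rule depth_avg_mono)
        fix xs :: "nat list" assume len: "length xs = Suc j"
        \<comment> \<open>By the recursion, \<open>?Q xs\<close> is the conditional mean of the next
          value, so appending \<open>Suc x\<close> adds the deviation of
          \<open>G (Suc j) (Suc x)\<close> from its average.\<close>
        have Q: "?Q xs = lsum (G (Suc j)) xs + lsum (\<lambda>d. G (Suc j) (Suc d)) xs / m - G 0 0"
          unfolding m_def sum_list_divide[symmetric] sum_list_addf[symmetric]
          by (simp only: rec[OF j, symmetric])
        have "(\<Sum>x\<leftarrow>xs. (lsum (G (Suc j)) (xs @ [Suc x]) - G 0 0) ^ (2 * p)) / m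
            = (\<Sum>x\<leftarrow>xs. (?Q xs + (G (Suc j) (Suc x) - lsum (\<lambda>d. G (Suc j) (Suc d)) xs / real (length xs))) ^ (2 * p)) / real (length xs)"
          unfolding Q len m_def[symmetric] by (simp add: algebra_simps)
        also have "\<dots> \<le> ?Q xs ^ (2 * p) + 4 ^ p * ((b j)\<^sup>2 * sqrt (real (length xs)) / A)
            * (?Q xs ^ (2 * p) + 4 * A ^ p * (?M xs / real (length xs)) / sqrt (real (length xs)))"
        proof (rule moment_step[OF p _ A])
          show "xs \<noteq> []" using len by auto
          show "(b j)\<^sup>2 * sqrt (real (length xs)) \<le> A" using bj len by (simp add: m_def)
          show "\<bar>G (Suc j) (Suc d) - G (Suc j) (Suc e)\<bar> \<le> b j * \<bar>real d - real e\<bar>" for d e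
            using lip[OF j, of "Suc d" "Suc e"] by simp
        qed
        finally show "(\<Sum>x\<leftarrow>xs. (lsum (G (Suc j)) (xs @ [Suc x]) - G 0 0) ^ (2 * p)) / m
            \<le> ?Q xs ^ (2 * p) + K * w j * (?Q xs ^ (2 * p) + 4 * A ^ p * (?M xs / m) / sqrt m)"
          unfolding K_def w_def len m_def .
      qed
      also have "\<dots> = X j + K * w j * (X j + 4 * A ^ p * (depth_avg j ?M / m) / sqrt m)"
        unfolding X_def by (simp only: depth_avg_add depth_avg_cmult depth_avg_divide)
      also have "\<dots> \<le> X j + K * w j * (X j + Y)"
      proof (intro add_left_mono mult_left_mono)
        have "depth_avg j ?M \<le> C * (m * sqrt m)" using C(2)[of j] by (simp add: m_def add.commute)
        then have "4 * A ^ p * (depth_avg j ?M / m) / sqrt m \<le> 4 * A ^ p * (C * (m * sqrt m) / m) / sqrt m"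
          using m A by (intro divide_right_mono mult_left_mono) auto
        then show "4 * A ^ p * (depth_avg j ?M / m) / sqrt m \<le> Y" using m by (simp add: Y_def mult_ac)
      qed (use K w0 in auto)
      finally show ?thesis .
    qed
    \<comment> \<open>Adding \<open>Y\<close> makes the step inequality purely multiplicative. The
      start is \<open>X 0 = 0\<close>, and the weights \<open>w\<close> sum to at most 1.\<close>
    have "X j + Y \<le> exp (K * (\<Sum>i<j. w i)) * Y" if "j \<le> n" for j
      using that
    proof (induction j)
      case 0
      then show ?case using p by (simp add: X_def power_0_left)
    next
      case (Suc j)
      have "X (Suc j) + Y \<le> (1 + K * w j) * (X j + Y)"
        using step[of j] Suc.prems by (simp add: algebra_simps)
      also have "\<dots> \<le> exp (K * w j) * (X j + Y)"
        using X Y by (intro mult_right_mono exp_ge_add_one_self) auto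
      also have "\<dots> \<le> exp (K * w j) * (exp (K * (\<Sum>i<j. w i)) * Y)"
        using Suc by (intro mult_left_mono) auto
      also have "\<dots> = exp (K * (\<Sum>i<Suc j. w i)) * Y" by (simp add: distrib_left exp_add)
      finally show ?case .
    qed
    from this[of n] have "X n \<le> exp (K * (\<Sum>i<n. w i)) * Y" using Y by linarith
    also have "\<dots> \<le> exp K * Y"
    proof -
      have "(\<Sum>i<n. w i) \<le> 1" using sum A by (simp add: w_def sum_divide_distrib[symmetric])
      then show ?thesis using K Y by (intro mult_right_mono) auto
    qed
    finally show ?thesis by (simp add: X_def Y_def mult.assoc)
  qed
  show thesis by (rule that[OF _ main]) (use C in auto)
qed

subsection \<open>Fourier bound for the martingale increments\<close>

lemma norm_cis_diff_le: "norm (cis a - cis b) \<le> \<bar>a - b\<bar>"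
proof -
  have "cis a - cis b = cis b * (exp (\<i> * of_real (a - b)) - 1)"
    unfolding cis_conv_exp[symmetric] by (simp add: right_diff_distrib cis_mult)
  then have "norm (cis a - cis b) = 2 * \<bar>sin ((a - b) / 2)\<bar>"
    by (simp only: norm_mult norm_cis dist_exp_i_1 mult_1)
  also have "\<dots> \<le> 2 * \<bar>(a - b) / 2\<bar>" by (intro mult_left_mono abs_sin_x_le_abs_x) auto
  finally show ?thesis by simp
qed

text \<open>Fourth-order Taylor expansion: \<open>x\<^sup>2 \<le> 10.5\<close> bounds the quartic
  term by \<open>7 / 16 * x\<^sup>2\<close>, and \<open>1 / 2 - 7 / 16 = 1 / 16\<close>.\<close>

lemma one_minus_cos_ge:
  assumes "\<bar>x\<bar> \<le> pi"
  shows "x\<^sup>2 / 16 \<le> 1 - cos x"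
proof -
  obtain t where t: "cos x = (\<Sum>m<4. cos_coeff m * x ^ m) + cos (t + 1 / 2 * real 4 * pi) / fact 4 * x ^ 4"
    using Maclaurin_cos_expansion[of x 4] by blast
  have "cos (t + 1 / 2 * real 4 * pi) / fact 4 * x ^ 4 \<le> 1 / fact 4 * x ^ 4"
    by (intro mult_right_mono divide_right_mono cos_le_one zero_le_even_power) auto
  moreover have "(\<Sum>m<4. cos_coeff m * x ^ m) = 1 - x\<^sup>2 / 2"
  proof -
    have "{..<4 :: nat} = {0, 1, 2, 3}" by auto
    then show ?thesis by (simp add: cos_coeff_def)
  qed
  moreover have "1 / fact 4 * x ^ 4 \<le> 7 / 16 * x\<^sup>2"
  proof -
    have "\<bar>x\<bar> \<le> 3.2" using assms pi_approx by simp
    then have "\<bar>x\<bar>\<^sup>2 \<le> 3.2\<^sup>2" by (intro power_mono) auto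
    then have "x\<^sup>2 \<le> 10.5" by (simp add: power2_eq_square)
    then have "x\<^sup>2 * x\<^sup>2 \<le> 10.5 * x\<^sup>2" by (intro mult_right_mono) auto
    moreover have "x ^ 4 = x\<^sup>2 * x\<^sup>2" using power_add[of x 2 2] by simp
    moreover have f4: "fact 4 = (24 :: real)" by (simp add: fact_numeral)
    ultimately show ?thesis unfolding f4 by linarith
  qed
  ultimately show ?thesis using t by linarith
qed

text \<open>The squared norm is \<open>(1 + y)\<^sup>2 - 2 * (1 - cos x) * y\<close> with
  \<open>y = 1 / i\<close>. Writing the gain as a power of \<open>1 + y\<close>, via
  \<open>ln (1 + y) \<le> y\<close>, lets the product over \<open>i\<close> telescope in
  \<open>norm_prod_cis_le\<close>.\<close>

lemma norm_one_plus_cis_le: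
  assumes x: "\<bar>x\<bar> \<le> pi" and i: "0 < i"
  shows "norm (1 + cis x / of_nat i) \<le> (1 + 1 / real i) powr (1 - x\<^sup>2 / 64)"
proof -
  define y where "y = 1 / real i"
  have y: "0 < y" "y \<le> 1" using i by (auto simp: y_def)
  have "1 + cis x / of_nat i = Complex (1 + cos x * y) (sin x * y)"
    by (simp add: complex_eq_iff y_def)
  then have "(norm (1 + cis x / of_nat i))\<^sup>2 = (1 + cos x * y)\<^sup>2 + (sin x * y)\<^sup>2"
    by (simp add: cmod_power2)
  also have "\<dots> = 1 + 2 * cos x * y + (cos x ^ 2 + sin x ^ 2) * y\<^sup>2" by algebra
  also have "\<dots> = (1 + y)\<^sup>2 - 2 * (1 - cos x) * y" by (simp add: power2_eq_square algebra_simps)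
  also have "\<dots> \<le> (1 + y)\<^sup>2 - 2 * (x\<^sup>2 / 16) * y"
    using one_minus_cos_ge[OF x] y by (intro diff_left_mono mult_right_mono) auto
  also have "\<dots> \<le> (1 + y)\<^sup>2 - (1 + y)\<^sup>2 * (x\<^sup>2 / 32 * y)"
  proof -
    have "(1 + y)\<^sup>2 \<le> 2\<^sup>2" using y by (intro power_mono) auto
    then have "(1 + y)\<^sup>2 * (x\<^sup>2 / 32 * y) \<le> 4 * (x\<^sup>2 / 32 * y)"
      using y by (intro mult_right_mono) auto
    moreover have "2 * (x\<^sup>2 / 16) * y = 4 * (x\<^sup>2 / 32 * y)" by simp
    ultimately show ?thesis by linarith
  qed
  also have "\<dots> = (1 + y)\<^sup>2 * (1 + - (x\<^sup>2 / 32 * y))" by (simp add: algebra_simps)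
  also have "\<dots> \<le> (1 + y)\<^sup>2 * exp (- (x\<^sup>2 / 32 * y))"
    by (intro mult_left_mono exp_ge_add_one_self) auto
  also have "\<dots> \<le> (1 + y)\<^sup>2 * exp (- (x\<^sup>2 / 32 * ln (1 + y)))"
    using y ln_add_one_self_le_self[of y] by (intro mult_left_mono) (auto intro!: mult_left_mono)
  also have "\<dots> = ((1 + y) powr (1 - x\<^sup>2 / 64))\<^sup>2"
  proof -
    have "(1 + y)\<^sup>2 * exp (- (x\<^sup>2 / 32 * ln (1 + y)))
        = exp (ln (1 + y) + ln (1 + y) + - (x\<^sup>2 / 32 * ln (1 + y)))"
      using y unfolding exp_add by (simp add: power2_eq_square)
    also have "\<dots> = exp ((1 - x\<^sup>2 / 64) * ln (1 + y) + (1 - x\<^sup>2 / 64) * ln (1 + y))"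
      by (simp add: algebra_simps)
    also have "\<dots> = ((1 + y) powr (1 - x\<^sup>2 / 64))\<^sup>2"
      using y unfolding exp_add by (simp add: powr_def power2_eq_square)
    finally show ?thesis .
  qed
  finally show ?thesis unfolding y_def[symmetric] by (rule power2_le_imp_le) auto
qed

lemma norm_prod_cis_le:
  assumes x: "\<bar>x\<bar> \<le> pi" and j: "j \<le> n"
  shows "norm (\<Prod>i=Suc j..n. 1 + cis x / of_nat i) \<le> ((real n + 1) / (real j + 1)) powr (1 - x\<^sup>2 / 64)"
  using j
proof (induction n rule: dec_induct)
  case (step n)
  have "norm (\<Prod>i=Suc j..Suc n. 1 + cis x / of_nat i)
      = norm (\<Prod>i=Suc j..n. 1 + cis x / of_nat i) * norm (1 + cis x / of_nat (Suc n))"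
    using step by (simp add: norm_mult del: of_nat_Suc)
  also have "\<dots> \<le> ((real n + 1) / (real j + 1)) powr (1 - x\<^sup>2 / 64) * (1 + 1 / real (Suc n)) powr (1 - x\<^sup>2 / 64)"
    using step x by (intro mult_mono norm_one_plus_cis_le) auto
  also have "\<dots> = (((real n + 1) / (real j + 1)) * (1 + 1 / real (Suc n))) powr (1 - x\<^sup>2 / 64)"
    by (rule powr_mult[symmetric]) 
  also have "((real n + 1) / (real j + 1)) * (1 + 1 / real (Suc n)) = (real (Suc n) + 1) / (real j + 1)"
  proof -
    have "a / b * (1 + 1 / a) = (a + 1) / b" if "a \<noteq> 0" for a b :: real
      using that by (simp add: distrib_left add_divide_distrib)
    from this[of "real n + 1" "real j + 1"] show ?thesis by (simp add: add.commute)
  qed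
  finally show ?case .
qed simp

lemma has_integral_arctan:
  fixes a :: real
  assumes a: "0 < a"
  shows "((\<lambda>x. 1 / (1 + a * x\<^sup>2)) has_integral (2 / sqrt a * arctan (sqrt a * pi))) {-pi..pi}"
proof -
  have "((\<lambda>x. 1 / (1 + a * x\<^sup>2)) has_integral
      (arctan (sqrt a * pi) / sqrt a - arctan (sqrt a * (- pi)) / sqrt a)) {-pi..pi}"
    using a
    by (intro fundamental_theorem_of_calculus)
      (auto intro!: derivative_eq_intros simp: has_real_derivative_iff_has_vector_derivative[symmetric]
        power_mult_distrib divide_simps)
  then show ?thesis by (simp add: arctan_minus)
qed

text \<open>Replaces the Gaussian factor in the Fourier integral by a rational one, whose
  antiderivative is an arctangent.\<close>

lemma square_exp_le:
  fixes u :: real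
  assumes "0 \<le> u"
  shows "u * exp (- u) \<le> 2 / (1 + u)"
proof -
  have "u * (1 + u) \<le> 2 * (1 + u + u\<^sup>2 / 2)" using assms by (simp add: power2_eq_square algebra_simps)
  also have "\<dots> \<le> 2 * exp u" using exp_lower_Taylor_quadratic[OF assms] by simp
  finally show ?thesis using assms by (simp add: exp_minus field_simps)
qed

text \<open>The expected value of \<open>Y k - Y m\<close> in the full tree is \<open>\<Sum>v. level_weight n k m j (depth v)\<close>
  given the first \<open>j + 1\<close> nodes \<open>v\<close>.\<close>

definition level_weight :: "nat \<Rightarrow> nat \<Rightarrow> nat \<Rightarrow> nat \<Rightarrow> nat \<Rightarrow> real" where
  "level_weight n k m j d = Re (integral {-pi..pi} (\<lambda>x. (cis (- real k * x) - cis (- real m * x))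
     * cis (real d * x) * (\<Prod>i=Suc j..n. 1 + cis x / of_nat i))) / (2 * pi)"

lemma level_weight_integrable:
  "(\<lambda>x. (cis (- real k * x) - cis (- real m * x)) * cis (real d * x)
    * (\<Prod>i\<in>I. 1 + cis x / of_nat i)) integrable_on {-pi..pi}"
  unfolding divide_inverse
  by (intro integrable_continuous_interval continuous_intros)

text \<open>Split off the factor \<open>i = Suc j\<close>; its \<open>cis x\<close> raises
  \<open>d\<close> by one.\<close>

lemma level_weight_rec:
  assumes j: "j < n"
  shows "level_weight n k m j d
    = level_weight n k m (Suc j) d + level_weight n k m (Suc j) (Suc d) / real (Suc j)"
proof -
  let ?f = "\<lambda>d x. (cis (- real k * x) - cis (- real m * x)) * cis (real d * x)
     * (\<Prod>i=Suc (Suc j)..n. 1 + cis x / of_nat i)"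
  have int: "?f d integrable_on {-pi..pi}" for d by (rule level_weight_integrable)
  have "(\<lambda>x. (cis (- real k * x) - cis (- real m * x)) * cis (real d * x)
      * (\<Prod>i=Suc j..n. 1 + cis x / of_nat i))
    = (\<lambda>x. ?f d x + ?f (Suc d) x * of_real (1 / real (Suc j)))"
  proof
    fix x
    have "(\<Prod>i=Suc j..n. 1 + cis x / of_nat i)
        = (1 + cis x / of_nat (Suc j)) * (\<Prod>i=Suc (Suc j)..n. 1 + cis x / of_nat i)"
      using j by (intro prod.atLeast_Suc_atMost) simp
    moreover have "cis (real (Suc d) * x) = cis (real d * x) * cis x"
      by (simp add: cis_mult algebra_simps)
    moreover have "K * E * ((1 + c / of_nat N) * P) = K * E * P + K * (E * c) * P * of_real (1 / real N)"
      for K E c P :: complex and N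
      by (simp add: algebra_simps)
    ultimately show "(cis (- real k * x) - cis (- real m * x)) * cis (real d * x)
      * (\<Prod>i=Suc j..n. 1 + cis x / of_nat i) = ?f d x + ?f (Suc d) x * of_real (1 / real (Suc j))"
      by (simp only:)
  qed
  then have "integral {-pi..pi} (\<lambda>x. (cis (- real k * x) - cis (- real m * x)) * cis (real d * x)
      * (\<Prod>i=Suc j..n. 1 + cis x / of_nat i))
    = integral {-pi..pi} (?f d) + integral {-pi..pi} (?f (Suc d)) * of_real (1 / real (Suc j))"
    using int[of d] int[of "Suc d"]
    by (simp only: integral_add integrable_on_mult_left integral_mult_left)
  moreover have "Re (u + v * of_real a) / b = Re u / b + Re v / b * a" for u v a b
    by (simp add: add_divide_distrib)
  ultimately show ?thesis
    unfolding level_weight_def by (simp only: divide_inverse mult_1_left)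
qed

lemma integral_cis:
  "integral {-pi..pi} (\<lambda>x. cis (of_int z * x)) = (if z = 0 then 2 * pi else 0)"
proof (cases "z = 0")
  case True
  then show ?thesis by (simp add: content_real scaleR_conv_of_real)
next
  case False
  have "((\<lambda>x. cis (of_int z * x)) has_integral
      cis (of_int z * pi) / (\<i> * of_int z) - cis (of_int z * (- pi)) / (\<i> * of_int z)) {-pi..pi}"
  proof (rule fundamental_theorem_of_calculus)
    fix x :: real
    have "((\<lambda>x. exp (\<i> * (of_int z * x)) / (\<i> * of_int z)) has_field_derivative
        exp (\<i> * (of_int z * of_real x)) * (\<i> * of_int z) / (\<i> * of_int z)) (at (of_real x))"
      using False by (intro DERIV_cdivide) (auto intro!: derivative_eq_intros)
    moreover have "exp (\<i> * (of_int z * of_real x)) * (\<i> * of_int z) / (\<i> * of_int z)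
        = exp (\<i> * (of_int z * of_real x))"
      by (rule nonzero_mult_div_cancel_right) (use False in simp)
    ultimately have "((\<lambda>x. exp (\<i> * (of_int z * x)) / (\<i> * of_int z)) has_field_derivative
        exp (\<i> * (of_int z * of_real x))) (at (of_real x))" by (simp only:)
    then have "((\<lambda>x. exp (\<i> * (of_int z * of_real x)) / (\<i> * of_int z)) has_vector_derivative
        exp (\<i> * (of_int z * of_real x))) (at x within {-pi..pi})"
      by (rule has_vector_derivative_real_field[THEN has_vector_derivative_at_within])
    then show "((\<lambda>x. cis (of_int z * x) / (\<i> * of_int z)) has_vector_derivative cis (of_int z * x))
        (at x within {-pi..pi})"
      by (simp add: cis_conv_exp)
  qed simp
  moreover have "cis (of_int z * pi) = cis (of_int z * (- pi))"
  proof -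
    have "cis (of_int z * pi) = cis (of_int z * (- pi)) * cis (2 * pi * of_int z)"
      by (simp add: cis_mult algebra_simps)
    then show ?thesis using cis_multiple_2pi[of "of_int z"] by simp
  qed
  ultimately show ?thesis using False by (simp add: integral_unique)
qed

text \<open>For \<open>j = n\<close> the product is empty and orthogonality of the characters
  remains.\<close>

lemma level_weight_top: "level_weight n k m n d = of_bool (d = k) - of_bool (d = m)"
proof -
  have int: "(\<lambda>x. cis (of_int z * x)) integrable_on {-pi..pi}" for z
    by (intro integrable_continuous_interval continuous_intros)
  have "(\<lambda>x. (cis (- real k * x) - cis (- real m * x)) * cis (real d * x)
     * (\<Prod>i=Suc n..n. 1 + cis x / of_nat i))
    = (\<lambda>x. cis (of_int (int d - int k) * x) - cis (of_int (int d - int m) * x))"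
    by (simp add: left_diff_distrib cis_mult algebra_simps)
  then have "integral {-pi..pi} (\<lambda>x. (cis (- real k * x) - cis (- real m * x)) * cis (real d * x)
     * (\<Prod>i=Suc n..n. 1 + cis x / of_nat i))
    = integral {-pi..pi} (\<lambda>x. cis (of_int (int d - int k) * x))
      - integral {-pi..pi} (\<lambda>x. cis (of_int (int d - int m) * x))"
    using int by (simp only: integral_diff)
  then show ?thesis
    unfolding level_weight_def integral_cis by auto
qed

text \<open>The differences in \<open>k\<close>, \<open>m\<close> and in \<open>d\<close>,
  \<open>e\<close> each supply a factor of size \<open>\<bar>x\<bar>\<close>, and the product decays
  like \<open>\<rho> * exp (- (x\<^sup>2 * ln \<rho> / 64))\<close>. Integrating
  \<open>x\<^sup>2\<close> against this decay yields the exponent \<open>- 3 / 2\<close> of the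
  logarithm, with \<open>512 = 64 * sqrt 64\<close>.\<close>

lemma level_weight_lipschitz:
  assumes j: "j \<le> n"
  defines "\<rho> \<equiv> (real n + 1) / (real j + 1)"
  shows "\<bar>level_weight n k m j d - level_weight n k m j e\<bar>
    \<le> 512 * exp 1 * \<bar>real k - real m\<bar> * (\<rho> / ((1 + ln \<rho>) * sqrt (1 + ln \<rho>))) * \<bar>real d - real e\<bar>"
proof -
  let ?f = "\<lambda>d x. (cis (- real k * x) - cis (- real m * x)) * cis (real d * x)
     * (\<Prod>i=Suc j..n. 1 + cis x / of_nat i)"
  define c where "c = \<bar>real k - real m\<bar> * \<bar>real d - real e\<bar> * \<rho>"
  have \<rho>: "1 \<le> \<rho>" using j by (simp add: \<rho>_def)
  \<comment> \<open>The added 1 keeps \<open>a\<close> positive when \<open>\<rho> = 1\<close>; it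
    costs \<open>exp (x\<^sup>2 / 64)\<close>, at most \<open>exp 1\<close> on the interval.\<close>
  define a where "a = (1 + ln \<rho>) / 64"
  have a: "0 < a" using \<rho> by (simp add: a_def add_pos_nonneg)
  have c: "0 \<le> c" using \<rho> by (simp add: c_def)
  have int: "?f d integrable_on {-pi..pi}" for d by (rule level_weight_integrable)
  have bound: "norm (?f d x - ?f e x) \<le> c * exp 1 * (2 / a) * (1 / (1 + a * x\<^sup>2))"
    if x: "x \<in> {-pi..pi}" for x
  proof -
    have x': "\<bar>x\<bar> \<le> pi" using x by auto
    have k: "norm (cis (- real k * x) - cis (- real m * x)) \<le> \<bar>real k - real m\<bar> * \<bar>x\<bar>"
      using norm_cis_diff_le[of "- real k * x" "- real m * x"]
      by (simp add: abs_mult[symmetric] left_diff_distrib abs_minus_commute)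
    have d: "norm (cis (real d * x) - cis (real e * x)) \<le> \<bar>real d - real e\<bar> * \<bar>x\<bar>"
      using norm_cis_diff_le[of "real d * x" "real e * x"]
      by (simp add: abs_mult[symmetric] left_diff_distrib)
    have "norm (?f d x - ?f e x) = norm (cis (- real k * x) - cis (- real m * x))
        * norm (cis (real d * x) - cis (real e * x)) * norm (\<Prod>i=Suc j..n. 1 + cis x / of_nat i)"
      unfolding norm_mult[symmetric] by (simp add: algebra_simps)
    also have "\<dots> \<le> (\<bar>real k - real m\<bar> * \<bar>x\<bar>) * (\<bar>real d - real e\<bar> * \<bar>x\<bar>) * \<rho> powr (1 - x\<^sup>2 / 64)"
      unfolding \<rho>_def using j by (intro mult_mono k d norm_prod_cis_le x') auto
    also have "\<dots> = c * (x\<^sup>2 * exp (x\<^sup>2 / 64) * exp (- (a * x\<^sup>2)))"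
    proof -
      have "\<rho> powr (1 - x\<^sup>2 / 64) = \<rho> * (exp (x\<^sup>2 / 64) * exp (- (a * x\<^sup>2)))"
      proof -
        have "\<rho> powr (1 - x\<^sup>2 / 64) = exp (ln \<rho> + (x\<^sup>2 / 64 + - (a * x\<^sup>2)))"
          using \<rho> by (simp add: powr_def a_def algebra_simps add_divide_distrib)
        then show ?thesis using \<rho> unfolding exp_add by simp
      qed
      moreover have "\<bar>x\<bar> * \<bar>x\<bar> = x\<^sup>2" by (simp add: power2_eq_square)
      ultimately show ?thesis by (simp add: c_def algebra_simps)
    qed
    also have "\<dots> \<le> c * (x\<^sup>2 * exp 1 * exp (- (a * x\<^sup>2)))"
    proof -
      have "\<bar>x\<bar> \<le> 8" using x' pi_less_4 by linarith
      then have "\<bar>x\<bar>\<^sup>2 \<le> 8\<^sup>2" by (intro power_mono) auto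
      then have "x\<^sup>2 / 64 \<le> 1" by simp
      then show ?thesis using c by (intro mult_left_mono mult_right_mono) auto
    qed
    also have "\<dots> = c * exp 1 / a * ((a * x\<^sup>2) * exp (- (a * x\<^sup>2)))" using a by simp
    also have "\<dots> \<le> c * exp 1 / a * (2 / (1 + a * x\<^sup>2))"
      using a c by (intro mult_left_mono square_exp_le) auto
    finally show ?thesis by simp
  qed
  have hi: "((\<lambda>x. c * exp 1 * (2 / a) * (1 / (1 + a * x\<^sup>2))) has_integral
      c * exp 1 * (2 / a) * (2 / sqrt a * arctan (sqrt a * pi))) {-pi..pi}"
    by (intro has_integral_mult_right has_integral_arctan a)
  have Re_le: "\<bar>Re z / (2 * pi)\<bar> \<le> norm z / (2 * pi)" for z
    using divide_right_mono[OF abs_Re_le_cmod[of z], of "2 * pi"] by simp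
  have eq: "level_weight n k m j d - level_weight n k m j e
      = Re (integral {-pi..pi} (\<lambda>x. ?f d x - ?f e x)) / (2 * pi)"
    unfolding level_weight_def using int[of d] int[of e]
    by (simp add: integral_diff diff_divide_distrib)
  have "\<bar>level_weight n k m j d - level_weight n k m j e\<bar>
      \<le> norm (integral {-pi..pi} (\<lambda>x. ?f d x - ?f e x)) / (2 * pi)"
    unfolding eq by (rule Re_le)
  also have "\<dots> \<le> c * exp 1 * (2 / a) * (2 / sqrt a * arctan (sqrt a * pi)) / (2 * pi)"
    using integral_norm_bound_integral[OF integrable_diff[OF int int] has_integral_integrable[OF hi] bound]
    unfolding integral_unique[OF hi] by (intro divide_right_mono) auto
  also have "\<dots> \<le> c * exp 1 * (2 / a) * (2 / sqrt a * (pi / 2)) / (2 * pi)"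
    using a c arctan_ubound[of "sqrt a * pi"] by (intro divide_right_mono mult_left_mono) auto
  also have "\<dots> = c * exp 1 / (a * sqrt a)" using a by (simp add: field_simps)
  also have "a * sqrt a = (1 + ln \<rho>) * sqrt (1 + ln \<rho>) / 512"
    by (simp add: a_def real_sqrt_divide)
  finally show ?thesis by (simp add: c_def algebra_simps)
qed

subsection \<open>The most populous level\<close>

text \<open>Apply \<open>ln u \<le> u - 1\<close> to the twelfth root of \<open>x\<close>; cubing
  gives the quarter power and \<open>1728 = 12 ^ 3\<close>.\<close>

lemma one_plus_ln_cube_le:
  fixes x :: real
  assumes "1 \<le> x"
  shows "(1 + ln x) ^ 3 \<le> 1728 * x powr (1 / 4)"
proof -
  have x: "0 < x" using assms by simp
  have "ln x = 12 * ln (x powr (1 / 12))" using x by (simp add: ln_powr)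
  also have "\<dots> \<le> 12 * (x powr (1 / 12) - 1)"
    using x by (intro mult_left_mono ln_le_minus_one) auto
  finally have "1 + ln x \<le> 12 * x powr (1 / 12)" by simp
  then have "(1 + ln x) ^ 3 \<le> (12 * x powr (1 / 12)) ^ 3"
    using assms by (intro power_mono) auto
  also have "\<dots> = 1728 * x powr (1 / 4)"
    using x by (simp add: power_mult_distrib powr_power)
  finally show ?thesis .
qed

text \<open>\<open>profile_moment\<close> is applied to \<open>G = level_weight n k m\<close>, whose
  value at the top is the difference of the two level indicators and whose value at the root is the
  difference of their means.\<close>

lemma profile_fluctuation:
  assumes p: "1 \<le> p"
  shows "\<exists>C>0. \<forall>n k m. depth_avg n (\<lambda>xs. (lsum (\<lambda>d. of_bool (d = k)) xs - lsum (\<lambda>d. of_bool (d = m)) xs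
      - (mean_profile n k - mean_profile n m)) ^ (2 * p))
    \<le> C * ((real k - real m)\<^sup>2 * (real n + 1)\<^sup>2 / L (Suc n) ^ 3) ^ p"
proof -
  obtain C where C: "C > 0" and mom: "\<And>n G b A. (\<And>j d. j < n \<Longrightarrow> G j d = G (Suc j) d + G (Suc j) (Suc d) / real (Suc j)) \<Longrightarrow>
    (\<And>j d e. j < n \<Longrightarrow> \<bar>G (Suc j) d - G (Suc j) e\<bar> \<le> b j * \<bar>real d - real e\<bar>) \<Longrightarrow>
    0 < A \<Longrightarrow> (\<Sum>j<n. (b j)\<^sup>2 * sqrt (real (Suc j))) \<le> A \<Longrightarrow>
    depth_avg n (\<lambda>xs. (lsum (G n) xs - G 0 0) ^ (2 * p)) \<le> C * A ^ p"
    by (rule profile_moment[OF p]) blast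
  \<comment> \<open>Exponent bookkeeping in \<open>x = j + 2\<close>: \<open>- 2\<close> from the
    squared ratio, \<open>1 / 2\<close> from the depth moments and \<open>1 / 4\<close> from the
    cubed logarithm give the summable \<open>- 5 / 4\<close>.\<close>
  define v where "v = (\<lambda>j. 1728 * real (j + 2) powr (- 5 / 4))"
  have sv: "summable v"
  proof -
    have "summable (\<lambda>j. real j powr (- 5 / 4))" by (simp add: summable_real_powr_iff)
    then have "summable (\<lambda>j. real (j + 2) powr (- 5 / 4))"
      by (subst summable_iff_shift[where f = "\<lambda>j. real j powr (- 5 / 4)"])
    then show ?thesis unfolding v_def by (rule summable_mult)
  qed
  define V where "V = suminf v"
  have v0: "0 < v j" for j by (simp add: v_def)
  have V: "0 < V" unfolding V_def by (rule suminf_pos[OF sv v0])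
  define K where "K = (512 * exp 1 :: real)\<^sup>2"
  have K: "0 < K" by (simp add: K_def)
  have "depth_avg n (\<lambda>xs. (lsum (\<lambda>d. of_bool (d = k)) xs - lsum (\<lambda>d. of_bool (d = m)) xs
      - (mean_profile n k - mean_profile n m)) ^ (2 * p))
    \<le> C * (K * V) ^ p * ((real k - real m)\<^sup>2 * (real n + 1)\<^sup>2 / L (Suc n) ^ 3) ^ p" for n k m
  \<comment> \<open>For \<open>k = m\<close> the normalization \<open>B\<close> would be zero,
    whereas \<open>profile_moment\<close> asks for a positive \<open>A\<close>.\<close>
  proof (cases "k = m")
    case True
    then show ?thesis using p by (simp add: depth_avg_const power_0_left)
  next
    case False
    define l where "l = L (Suc n)"
    have l: "1 \<le> l" unfolding l_def by (rule L_ge_1)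
    define r where "r = (\<lambda>j. (real n + 1) / real (j + 2))"
    define b where "b = (\<lambda>j. 512 * exp 1 * \<bar>real k - real m\<bar> * (r j / ((1 + ln (r j)) * sqrt (1 + ln (r j)))))"
    define B where "B = (real k - real m)\<^sup>2 * (real n + 1)\<^sup>2 / l ^ 3"
    have B: "0 < B" using False l by (simp add: B_def)
    have lsum_top: "lsum (level_weight n k m n) xs = lsum (\<lambda>d. of_bool (d = k)) xs - lsum (\<lambda>d. of_bool (d = m)) xs" for xs
      by (induction xs) (simp_all add: level_weight_top)
    have mean: "level_weight n k m 0 0 = mean_profile n k - mean_profile n m"
      using depth_avg_lsum_linear[of n "level_weight n k m"] level_weight_rec[of _ n k m]
      unfolding lsum_top depth_avg_diff mean_profile_def by simp
    have bj: "(b j)\<^sup>2 * sqrt (real (Suc j)) \<le> K * B * v j" if j: "j < n" for j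
    proof -
      define x where "x = real (j + 2)"
      define y where "y = 1 + ln (r j)"
      have x: "1 \<le> x" by (simp add: x_def)
      have rj: "1 \<le> r j" "r j = (real n + 1) / x" using j by (auto simp: r_def x_def)
      have y: "1 \<le> y" using rj by (simp add: y_def)
      have "ln (real n + 1) = ln (r j) + ln x" using x unfolding rj by (simp add: ln_div)
      \<comment> \<open>From \<open>n + 1 = r j * x\<close>: the sum of logarithms is bounded by a
        product, which extracts \<open>l ^ 3\<close> uniformly in \<open>j\<close> at the price of
        \<open>(1 + ln x) ^ 3\<close>.\<close>
      then have "ln (real n + 1) + 1 \<le> y * (1 + ln x)"
        using y x by (simp add: y_def algebra_simps)
      moreover have "0 \<le> ln (real n + 1)" by simp
      moreover have "l = max (ln (real n + 1)) 1" by (simp add: l_def L_def add.commute)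
      ultimately have "l \<le> y * (1 + ln x)" by linarith
      then have "l ^ 3 \<le> (y * (1 + ln x)) ^ 3" using l by (intro power_mono) auto
      also have "\<dots> \<le> y ^ 3 * (1728 * x powr (1 / 4))"
        unfolding power_mult_distrib using y by (intro mult_left_mono one_plus_ln_cube_le x) auto
      finally have ly: "1 / y ^ 3 \<le> 1728 * x powr (1 / 4) / l ^ 3"
        using l y by (simp add: divide_simps mult.commute)
      have "(b j)\<^sup>2 = K * (real k - real m)\<^sup>2 * (r j)\<^sup>2 * (1 / y ^ 3)"
      proof -
        define z where "z = y * sqrt y"
        have "z\<^sup>2 = y ^ 3" using y by (simp add: z_def power_mult_distrib power3_eq_cube power2_eq_square)
        then show ?thesis
          unfolding b_def K_def y_def[symmetric] z_def[symmetric]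
          by (simp add: power_mult_distrib power_divide)
      qed
      also have "\<dots> \<le> K * (real k - real m)\<^sup>2 * (r j)\<^sup>2 * (1728 * x powr (1 / 4) / l ^ 3)"
        using K ly by (intro mult_left_mono) auto
      also have "\<dots> = K * B * (1728 * x powr (1 / 4) / x\<^sup>2)"
        by (simp add: rj B_def power_divide mult_ac)
      finally have "(b j)\<^sup>2 * sqrt (real (Suc j)) \<le> K * B * (1728 * x powr (1 / 4) / x\<^sup>2) * sqrt x"
        using K B x by (intro mult_mono real_sqrt_le_mono) (auto simp: x_def)
      also have "\<dots> = K * B * (1728 * (x powr (1 / 4) * x powr (1 / 2) / x powr 2))"
        using x by (simp add: powr_half_sqrt powr_numeral)
      also have "x powr (1 / 4) * x powr (1 / 2) / x powr 2 = x powr (- 5 / 4)"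
        using x unfolding powr_add[symmetric] powr_diff[symmetric] by simp
      finally show ?thesis by (simp add: v_def x_def)
    qed
    have "(\<Sum>j<n. (b j)\<^sup>2 * sqrt (real (Suc j))) \<le> (\<Sum>j<n. K * B * v j)"
      using bj by (intro sum_mono) auto
    also have "\<dots> = K * B * (\<Sum>j<n. v j)" by (simp add: sum_distrib_left)
    also have "\<dots> \<le> K * B * V"
      unfolding V_def using K B v0 by (intro mult_left_mono sum_le_suminf sv) (auto intro: less_imp_le)
    finally have "depth_avg n (\<lambda>xs. (lsum (level_weight n k m n) xs - level_weight n k m 0 0) ^ (2 * p))
        \<le> C * (K * B * V) ^ p"
      using K B V level_weight_rec level_weight_lipschitz[of "Suc _" n k m]
      by (intro mom[where b = b]) (auto simp: b_def r_def)
    also have "\<dots> = C * (K * V) ^ p * B ^ p" by (simp add: power_mult_distrib)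
    finally show ?thesis unfolding lsum_top mean by (simp add: B_def l_def)
  qed
  moreover have "0 < C * (K * V) ^ p" using C K V by simp
  ultimately show ?thesis by blast
qed

text \<open>Markov's inequality for the \<open>2 * p\<close>-th moment: the squared mean gap is at
  least of order \<open>N\<^sup>2 * d ^ 3 / l ^ 3\<close>, the squared fluctuation at most of order
  \<open>N\<^sup>2 * d\<^sup>2 / l ^ 3\<close>, so each power of the quotient gains
  \<open>1 / d\<close>.\<close>

lemma level_exceeds_mode:
  assumes p: "1 \<le> p"
  shows "\<exists>C>0. \<forall>n k m. (\<forall>j. mean_profile n j \<le> mean_profile n m) \<longrightarrow> \<bar>real m - L (Suc n)\<bar> \<le> 5 \<longrightarrow>
    12 \<le> \<bar>real k - L (Suc n)\<bar> \<longrightarrow> \<bar>real k - L (Suc n)\<bar> ^ 3 \<le> (L (Suc n))\<^sup>2 \<longrightarrow>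
    depth_avg n (\<lambda>xs. of_bool (lsum (\<lambda>d. of_bool (d = m)) xs \<le> lsum (\<lambda>d. of_bool (d = k)) xs))
      \<le> C / \<bar>real k - L (Suc n)\<bar> ^ p"
proof -
  obtain C where C: "C > 0" and fluct: "\<And>n k m. depth_avg n (\<lambda>xs. (lsum (\<lambda>d. of_bool (d = k)) xs - lsum (\<lambda>d. of_bool (d = m)) xs
      - (mean_profile n k - mean_profile n m)) ^ (2 * p))
    \<le> C * ((real k - real m)\<^sup>2 * (real n + 1)\<^sup>2 / L (Suc n) ^ 3) ^ p"
    using profile_fluctuation[OF p] by blast
  \<comment> \<open>\<open>1156 = 34\<^sup>2\<close> comes from \<open>mean_profile_max_ge\<close>,
    and \<open>1600 = 400 * 4\<close> from \<open>min2\<close> and the halved minimum.\<close>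
  define c :: real where "c = 1 / (1156 * 1600)"
  have c: "0 < c" by (simp add: c_def)
  have "depth_avg n (\<lambda>xs. of_bool (lsum (\<lambda>d. of_bool (d = m)) xs \<le> lsum (\<lambda>d. of_bool (d = k)) xs))
      \<le> C * (4 / c) ^ p / \<bar>real k - L (Suc n)\<bar> ^ p"
    if max: "\<And>j. mean_profile n j \<le> mean_profile n m" and m: "\<bar>real m - L (Suc n)\<bar> \<le> 5"
      and d12: "12 \<le> \<bar>real k - L (Suc n)\<bar>" and d3: "\<bar>real k - L (Suc n)\<bar> ^ 3 \<le> (L (Suc n))\<^sup>2"
    for n k m
  proof -
    define l where "l = L (Suc n)"
    define d where "d = \<bar>real k - l\<bar>"
    define M where "M = mean_profile n m"
    define g where "g = M - mean_profile n k"
    define N where "N = real n + 1"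
    have N: "0 < N" by (simp add: N_def)
    have l: "1 \<le> l" unfolding l_def by (rule L_ge_1)
    have d: "12 \<le> d" "d ^ 3 \<le> l\<^sup>2" using d12 d3 by (auto simp: d_def l_def)
    have dl: "d \<le> l"
    proof (rule ccontr)
      assume "\<not> d \<le> l"
      then have "l ^ 3 < d ^ 3" using l by (intro power_strict_mono) auto
      moreover have "l\<^sup>2 \<le> l ^ 3" using l by (intro power_increasing) auto
      ultimately show False using d by simp
    qed
    define x where "x = d\<^sup>2 / (20 * l)"
    have x: "0 < x" using d l by (simp add: x_def)
    have M: "N / (34 * sqrt l) \<le> M"
      unfolding M_def N_def l_def by (rule mean_profile_max_ge[OF max])
    have M0: "0 < M" using M N l by (smt (verit) divide_pos_pos mult_pos_pos real_sqrt_gt_zero)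
    have "mean_profile n k \<le> exp (- (real k - l)\<^sup>2 / (20 * l)) * M"
      using mean_profile_gaussian_decay[of k n M] d12 dl max by (simp add: M_def l_def d_def)
    also have "- (real k - l)\<^sup>2 / (20 * l) = - x" by (simp add: x_def d_def)
    finally have g1: "M * (1 - exp (- x)) \<le> g" by (simp add: g_def algebra_simps)
    have "min 1 x / 2 \<le> 1 - exp (- x)"
    proof -
      have "1 + x \<le> exp x" by (rule exp_ge_add_one_self)
      then have "exp (- x) \<le> 1 / (1 + x)" using x by (simp add: exp_minus inverse_eq_divide frac_le)
      moreover have "1 / (1 + x) \<le> 1 - min 1 x / 2"
        using x by (cases "x \<le> 1") (auto simp: min_def divide_simps algebra_simps intro: mult_left_le)
      ultimately show ?thesis by linarith
    qed
    then have g2: "M * (min 1 x / 2) \<le> g"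
      using g1 M0 mult_left_mono[of "min 1 x / 2" "1 - exp (- x)" M] by linarith
    \<comment> \<open>Weakening \<open>d ^ 4\<close> to \<open>d ^ 3\<close> gives one lower bound
      for both cases; for \<open>x > 1\<close> it uses the assumption
      \<open>d ^ 3 \<le> l\<^sup>2\<close>.\<close>
    have min2: "d ^ 3 / (400 * l\<^sup>2) \<le> (min 1 x)\<^sup>2"
    proof (cases "x \<le> 1")
      case True
      have "d ^ 3 / (400 * l\<^sup>2) \<le> d ^ 4 / (400 * l\<^sup>2)"
        using d l by (intro divide_right_mono power_increasing) auto
      also have "\<dots> = x\<^sup>2" by (simp add: x_def power_divide power_mult_distrib)
      finally show ?thesis using True by (simp add: min_def)
    next
      case False
      have "d ^ 3 \<le> 400 * l\<^sup>2" using d(2) zero_le_power2[of l] by linarith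
      then have "d ^ 3 / (400 * l\<^sup>2) \<le> 1" using l by (simp add: divide_le_eq)
      then show ?thesis using False by (simp add: min_def)
    qed
    have g0: "0 \<le> g" using g2 M0 x by (smt (verit) divide_nonneg_nonneg mult_nonneg_nonneg)
    define h where "h = c * N\<^sup>2 * d ^ 3 / l ^ 3"
    have h0: "0 < h" using c N d l by (simp add: h_def)
    have "h = (N / (34 * sqrt l))\<^sup>2 * (d ^ 3 / (400 * l\<^sup>2) / 4)"
      using l by (simp add: h_def c_def power_divide power_mult_distrib eval_nat_numeral)
    also have "\<dots> \<le> M\<^sup>2 * ((min 1 x)\<^sup>2 / 4)"
      using M N l d min2 by (intro mult_mono power_mono divide_right_mono) auto
    also have "\<dots> = (M * (min 1 x / 2))\<^sup>2" by (simp add: power_mult_distrib power_divide)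
    also have "\<dots> \<le> g\<^sup>2" using g2 M0 x by (intro power_mono) auto
    finally have hg: "h \<le> g\<^sup>2" .
    let ?Z = "\<lambda>xs. lsum (\<lambda>d. of_bool (d = k)) xs - lsum (\<lambda>d. of_bool (d = m)) xs
      - (mean_profile n k - mean_profile n m)"
    have "depth_avg n (\<lambda>xs. of_bool (lsum (\<lambda>d. of_bool (d = m)) xs \<le> lsum (\<lambda>d. of_bool (d = k)) xs))
        \<le> depth_avg n (\<lambda>xs. ?Z xs ^ (2 * p) / h ^ p)"
    proof (rule depth_avg_mono)
      fix xs :: "nat list"
      show "of_bool (lsum (\<lambda>d. of_bool (d = m)) xs \<le> lsum (\<lambda>d. of_bool (d = k)) xs) \<le> ?Z xs ^ (2 * p) / h ^ p"
      proof (cases "lsum (\<lambda>d. of_bool (d = m)) xs \<le> lsum (\<lambda>d. of_bool (d = k)) xs")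
        case True
        then have "g \<le> ?Z xs" by (simp add: g_def M_def)
        then have "h ^ p \<le> (?Z xs ^ 2) ^ p"
          using hg h0 g0 by (intro power_mono order_trans[OF hg]) auto
        then show ?thesis using h0 True by (simp add: power_mult)
      next
        case False
        then show ?thesis using h0 by (simp add: power_mult)
      qed
    qed
    also have "\<dots> = depth_avg n (\<lambda>xs. ?Z xs ^ (2 * p)) / h ^ p" by (rule depth_avg_divide)
    also have "\<dots> \<le> C * ((real k - real m)\<^sup>2 * N\<^sup>2 / l ^ 3) ^ p / h ^ p"
      unfolding N_def l_def using h0 by (intro divide_right_mono fluct) auto
    also have "\<dots> \<le> C * ((2 * d)\<^sup>2 * N\<^sup>2 / l ^ 3) ^ p / h ^ p"
    proof -
      have "\<bar>real k - real m\<bar> \<le> 2 * d" 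
        using abs_triangle_ineq4[of "real k - l" "real m - l"] m d(1) by (simp add: d_def l_def)
      then have "(real k - real m)\<^sup>2 \<le> (2 * d)\<^sup>2" by (metis abs_ge_zero power2_abs power_mono)
      then have "(real k - real m)\<^sup>2 * N\<^sup>2 / l ^ 3 \<le> (2 * d)\<^sup>2 * N\<^sup>2 / l ^ 3"
        using l by (intro divide_right_mono mult_right_mono) auto
      then have "((real k - real m)\<^sup>2 * N\<^sup>2 / l ^ 3) ^ p \<le> ((2 * d)\<^sup>2 * N\<^sup>2 / l ^ 3) ^ p"
        by (rule power_mono) (use l in simp)
      then show ?thesis by (rule divide_right_mono[OF mult_left_mono]) (use C h0 in auto)
    qed
    also have "\<dots> = C * (((2 * d)\<^sup>2 * N\<^sup>2 / l ^ 3) / h) ^ p"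
      by (simp add: power_divide power_mult_distrib)
    also have "((2 * d)\<^sup>2 * N\<^sup>2 / l ^ 3) / h = (4 / c) / d"
      using N l d c by (simp add: h_def power_mult_distrib eval_nat_numeral)
    finally show ?thesis by (simp add: power_divide power_mult_distrib d_def l_def)
  qed
  moreover have "0 < C * (4 / c) ^ p" using C c by simp
  ultimately show ?thesis by blast
qed

section \<open>Union bound over the levels\<close>

lemma sum_inverse_squares_inj_le:
  fixes f :: "'a \<Rightarrow> nat"
  assumes "finite K" "inj_on f K" "\<And>k. k \<in> K \<Longrightarrow> 1 \<le> f k"
  shows "(\<Sum>k\<in>K. 1 / real (f k) ^ 2) \<le> 2"
proof -
  have "(\<Sum>k\<in>K. 1 / real (f k) ^ 2) = (\<Sum>i\<in>f ` K. 1 / real i ^ 2)"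
    by (simp add: sum.reindex[OF assms(2)])
  also have "\<dots> \<le> (\<Sum>i=1..Max (f ` K). 1 / real i ^ 2)"
    using assms(1,3) by (intro sum_mono2) auto
  also have "\<dots> \<le> 2" by (rule sum_inverse_squares_le)
  finally show ?thesis .
qed

text \<open>On either side of the integer part of \<open>l\<close>, the distances can be replaced by
  distinct positive integers \<open>f k \<le> 2 * \<bar>real k - l\<bar>\<close>; each side
  contributes at most \<open>4 * 2\<close>.\<close>

lemma sum_inverse_square_dist_le:
  fixes K :: "nat set" and l :: real
  assumes K: "finite K" "\<And>k. k \<in> K \<Longrightarrow> 1 \<le> \<bar>real k - l\<bar>" and l: "0 \<le> l"
  shows "(\<Sum>k\<in>K. 1 / (real k - l)\<^sup>2) \<le> 16"
proof -
  have part: "(\<Sum>k\<in>A. 1 / (real k - l)\<^sup>2) \<le> 8"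
    if "A \<subseteq> K" "inj_on f A" "\<And>k. k \<in> A \<Longrightarrow> 1 \<le> f k \<and> real (f k) \<le> \<bar>real k - l\<bar> + 1"
    for A and f :: "nat \<Rightarrow> nat"
  proof -
    have "(\<Sum>k\<in>A. 1 / (real k - l)\<^sup>2) \<le> (\<Sum>k\<in>A. 4 * (1 / real (f k) ^ 2))"
    proof (rule sum_mono)
      fix k assume k: "k \<in> A"
      have "real (f k) \<le> 2 * \<bar>real k - l\<bar>" using that(3)[OF k] K(2)[of k] that(1) k by force
      then have "real (f k) ^ 2 \<le> (2 * \<bar>real k - l\<bar>)\<^sup>2" by (intro power_mono) auto
      then have "real (f k) ^ 2 \<le> 4 * (real k - l)\<^sup>2" by (simp add: power_mult_distrib)
      moreover have "0 < real (f k) ^ 2" using that(3)[OF k] by simp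
      moreover have "0 < (real k - l)\<^sup>2" using calculation by linarith
      ultimately have "4 / (4 * (real k - l)\<^sup>2) \<le> 4 / real (f k) ^ 2"
        by (intro divide_left_mono) auto
      then show "1 / (real k - l)\<^sup>2 \<le> 4 * (1 / real (f k) ^ 2)" by simp
    qed
    also have "\<dots> \<le> 4 * 2"
      unfolding sum_distrib_left[symmetric]
      using that K finite_subset[OF that(1)] by (intro mult_left_mono sum_inverse_squares_inj_le) auto
    finally show ?thesis by simp
  qed
  define z where "z = nat \<lfloor>l\<rfloor>"
  have z: "real z \<le> l" "l < real z + 1" using l unfolding z_def by linarith+
  have "(\<Sum>k\<in>K. 1 / (real k - l)\<^sup>2)
      = (\<Sum>k\<in>{k\<in>K. z < k}. 1 / (real k - l)\<^sup>2) + (\<Sum>k\<in>{k\<in>K. \<not> z < k}. 1 / (real k - l)\<^sup>2)"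
    using K(1) by (subst sum.union_disjoint[symmetric]) (auto intro!: sum.cong)
  also have "\<dots> \<le> 8 + 8"
  proof (rule add_mono)
    show "(\<Sum>k\<in>{k\<in>K. z < k}. 1 / (real k - l)\<^sup>2) \<le> 8"
      using z by (intro part[where f = "\<lambda>k. k - z"]) (auto intro!: inj_onI simp: of_nat_diff)
    show "(\<Sum>k\<in>{k\<in>K. \<not> z < k}. 1 / (real k - l)\<^sup>2) \<le> 8"
      using z by (intro part[where f = "\<lambda>k. Suc z - k"]) (auto intro!: inj_onI simp: of_nat_diff Suc_diff_le)
  qed
  finally show ?thesis by simp
qed

text \<open>The existential quantifier ranges over all maximal levels, so the event covers every
  rule for breaking ties.\<close>

definition max_level_far :: "nat \<Rightarrow> real \<Rightarrow> nat list \<Rightarrow> bool" where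
  "max_level_far n T xs \<longleftrightarrow> (\<exists>k. T \<le> \<bar>real k - L (Suc n)\<bar> \<and>
     (\<forall>j. lsum (\<lambda>d. of_bool (d = j)) xs \<le> lsum (\<lambda>d. of_bool (d = k)) xs))"

lemma max_level_very_far_tail:
  assumes B: "0 < B"
  shows "\<exists>C>0. \<forall>n T. 1 \<le> T \<longrightarrow> (L (Suc n))\<^sup>2 \<le> T ^ 3 \<longrightarrow>
    depth_avg n (\<lambda>xs. of_bool (max_level_far n T xs)) \<le> C * T powr (- B)"
proof -
  \<comment> \<open>The exponent exceeds \<open>B\<close> by one to pay for the factor
    \<open>4 * T\<close> from the number of near levels; \<open>q = 2 * r\<close> turns
    \<open>sqrt T ^ q\<close> into \<open>T ^ r\<close>.\<close>
  define r where "r = nat \<lceil>B\<rceil> + 1"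
  define q where "q = 2 * r"
  define C where "C = 8 * exp 4 * (4 * real q) ^ q"
  have q: "1 \<le> q" "B + 1 \<le> real r" using real_nat_ceiling_ge[of B] by (auto simp: q_def r_def)
  have C: "0 < C" using q by (simp add: C_def)
  have "depth_avg n (\<lambda>xs. of_bool (max_level_far n T xs)) \<le> C * T powr (- B)"
    if T: "1 \<le> T" and lT: "(L (Suc n))\<^sup>2 \<le> T ^ 3" for n T
  proof -
    define l where "l = L (Suc n)"
    \<comment> \<open>Since \<open>l \<le> T * sqrt T\<close>, this gives
      \<open>l * s\<^sup>2 \<le> sqrt T / 4\<close> against
      \<open>s * T = sqrt T / 2\<close>.\<close>
    define s where "s = 1 / (2 * sqrt T)"
    let ?far = "\<lambda>d. of_bool (T \<le> \<bar>real d - l\<bar>) :: real"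
    let ?Y = "\<lambda>k. lsum (\<lambda>d. of_bool (d = k))"
    have s: "0 < s" "s \<le> 1" using T real_sqrt_ge_one[OF T] by (auto simp: s_def divide_le_eq simp del: real_sqrt_ge_1_iff)
    have "depth_avg n (\<lambda>xs. of_bool (max_level_far n T xs))
        \<le> depth_avg n (\<lambda>xs. (2 * T + 2) / (real n + 1) * lsum ?far xs)"
    proof (rule depth_avg_mono)
      fix xs :: "nat list" assume len: "length xs = Suc n"
      have far0: "0 \<le> lsum ?far xs" by (intro sum_list_nonneg) auto
      show "of_bool (max_level_far n T xs) \<le> (2 * T + 2) / (real n + 1) * lsum ?far xs"
      proof (cases "max_level_far n T xs")
        case True
        then obtain k where k: "T \<le> \<bar>real k - l\<bar>" "\<And>j. ?Y j xs \<le> ?Y k xs"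
          unfolding max_level_far_def l_def by blast
        have kfar: "?Y k xs \<le> lsum ?far xs" using k(1) by (intro sum_list_mono) auto
        have "real n + 1 \<le> lsum ?far xs + (\<Sum>j\<in>{j :: nat. \<bar>real j - l\<bar> < T}. ?Y j xs)"
          using count_near_or_far[of xs T l] len by simp
        also have "(\<Sum>j\<in>{j :: nat. \<bar>real j - l\<bar> < T}. ?Y j xs)
            \<le> (\<Sum>j\<in>{j :: nat. \<bar>real j - l\<bar> < T}. lsum ?far xs)"
          by (intro sum_mono order_trans[OF k(2) kfar])
        also have "\<dots> = real (card {j :: nat. \<bar>real j - l\<bar> < T}) * lsum ?far xs" by simp
        also have "\<dots> \<le> (2 * T + 1) * lsum ?far xs"
          using T far0 by (intro mult_right_mono near_levels(2)) auto
        finally have "real n + 1 \<le> (2 * T + 2) * lsum ?far xs" by (simp add: algebra_simps)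
        then show ?thesis using True by (simp add: le_divide_eq)
      qed (use far0 T in auto)
    qed
    also have "\<dots> = (2 * T + 2) / (real n + 1) * depth_avg n (lsum ?far)"
      by (rule depth_avg_cmult)
    also have "\<dots> \<le> (2 * T + 2) / (real n + 1) * (2 * exp 4 * (real n + 1) * exp (l * s\<^sup>2 - s * T))"
      unfolding l_def using T by (intro mult_left_mono depth_tail s) auto
    also have "\<dots> = (2 * T + 2) * (2 * exp 4 * exp (l * s\<^sup>2 - s * T))"
      by simp
    also have "\<dots> \<le> (4 * T) * (2 * exp 4 * (T powr (- B) * ((4 * real q) ^ q / T)))"
    proof (rule mult_mono)
      show "2 * T + 2 \<le> 4 * T" using T by simp
      have "l \<le> T * sqrt T"
      proof (rule power2_le_imp_le)
        show "l\<^sup>2 \<le> (T * sqrt T)\<^sup>2"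
        proof -
          have "(T * sqrt T)\<^sup>2 = T ^ 3"
            using T by (simp add: power_mult_distrib power3_eq_cube power2_eq_square)
          then show ?thesis using lT by (simp add: l_def)
        qed
      qed (use T in auto)
      then have "l * s\<^sup>2 \<le> T * sqrt T * s\<^sup>2" by (intro mult_right_mono) auto
      also have "\<dots> = sqrt T / 4" using T by (simp add: s_def power_divide power_mult_distrib)
      finally have "l * s\<^sup>2 \<le> sqrt T / 4" .
      moreover have "s * T = sqrt T / 2" using T real_div_sqrt[of T] by (simp add: s_def field_simps)
      ultimately have "l * s\<^sup>2 - s * T \<le> - (sqrt T / 4)" by simp
      then have "exp (l * s\<^sup>2 - s * T) \<le> exp (- (sqrt T / 4))" by simp
      also have "\<dots> \<le> (4 * real q) ^ q / T ^ r"
      proof -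
        have "(sqrt T / 4 / real q) ^ q \<le> (1 + sqrt T / 4 / real q) ^ q"
          using T by (intro power_mono) auto
        also have "\<dots> \<le> exp (sqrt T / 4)"
          using q T by (intro exp_ge_one_plus_x_over_n_power_n) (auto intro: order_trans[of _ 0])
        also have "(sqrt T / 4 / real q) ^ q = T ^ r / (4 * real q) ^ q"
          using T by (simp add: power_divide q_def power_mult power_mult_distrib)
        finally have "1 / exp (sqrt T / 4) \<le> 1 / (T ^ r / (4 * real q) ^ q)"
          using T q by (intro divide_left_mono) auto
        then show ?thesis by (simp add: exp_minus inverse_eq_divide)
      qed
      also have "\<dots> = (4 * real q) ^ q * T powr (- real r)"
        using T by (simp add: powr_minus powr_realpow divide_inverse)
      also have "\<dots> \<le> (4 * real q) ^ q * T powr (- B - 1)"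
        using T q by (intro mult_left_mono powr_mono) auto
      also have "\<dots> = T powr (- B) * ((4 * real q) ^ q / T)"
        using T by (simp add: powr_diff)
      finally show "2 * exp 4 * exp (l * s\<^sup>2 - s * T) \<le> 2 * exp 4 * (T powr (- B) * ((4 * real q) ^ q / T))"
        by (rule mult_left_mono) simp
    qed (use T in auto)
    also have "\<dots> = C * T powr (- B)" using T by (simp add: C_def)
    finally show ?thesis .
  qed
  then show ?thesis using C by blast
qed

lemma max_level_far_tail:
  assumes B: "0 < B"
  shows "\<exists>C>0. \<forall>n T. 12 < T \<longrightarrow>
    depth_avg n (\<lambda>xs. of_bool (max_level_far n T xs)) \<le> C * T powr (- B)"
proof -
  define q where "q = nat \<lceil>B\<rceil>"
  have q: "B \<le> real q" unfolding q_def by (rule real_nat_ceiling_ge)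
  let ?Y = "\<lambda>k. lsum (\<lambda>d. of_bool (d = k))"
  obtain C1 where C1: "C1 > 0" and far: "\<And>n T. 1 \<le> T \<Longrightarrow> (L (Suc n))\<^sup>2 \<le> T ^ 3 \<Longrightarrow>
    depth_avg n (\<lambda>xs. of_bool (max_level_far n T xs)) \<le> C1 * T powr (- B)"
    using max_level_very_far_tail[OF B] by blast
  obtain C2 where C2: "C2 > 0" and near: "\<And>n k m. (\<And>j. mean_profile n j \<le> mean_profile n m) \<Longrightarrow>
    \<bar>real m - L (Suc n)\<bar> \<le> 5 \<Longrightarrow> 12 \<le> \<bar>real k - L (Suc n)\<bar> \<Longrightarrow> \<bar>real k - L (Suc n)\<bar> ^ 3 \<le> (L (Suc n))\<^sup>2 \<Longrightarrow>
    depth_avg n (\<lambda>xs. of_bool (?Y m xs \<le> ?Y k xs)) \<le> C2 / \<bar>real k - L (Suc n)\<bar> ^ (q + 2)"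
    \<comment> \<open>Two powers beyond \<open>q\<close> are reserved for the convergence of the sum
      over \<open>k\<close>.\<close>
    using level_exceeds_mode[of "q + 2"] by auto
  have "depth_avg n (\<lambda>xs. of_bool (max_level_far n T xs)) \<le> (C1 + 16 * C2) * T powr (- B)"
    if T: "12 < T" for n T
  proof (cases "(L (Suc n))\<^sup>2 \<le> T ^ 3")
    case True
    have "depth_avg n (\<lambda>xs. of_bool (max_level_far n T xs)) \<le> C1 * T powr (- B)"
      using T True by (intro far) auto
    also have "\<dots> \<le> (C1 + 16 * C2) * T powr (- B)" using C2 by (intro mult_right_mono) auto
    finally show ?thesis .
  next
    case False
    define l where "l = L (Suc n)"
    have l: "1 \<le> l" unfolding l_def by (rule L_ge_1)
    \<comment> \<open>The border \<open>S ^ 3 = l\<^sup>2\<close> between the two estimates: from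
      \<open>S\<close> on the pigeonhole tail applies, and below it each level is compared with the
      mode.\<close>
    define S where "S = l powr (2 / 3)"
    have S3: "S ^ 3 = l\<^sup>2" using l by (simp add: S_def powr_power powr_numeral)
    have TS: "T < S"
      using False S3 l by (intro power_less_imp_less_base[of T 3 S]) (auto simp: l_def S_def)
    define K where "K = {k :: nat. T \<le> \<bar>real k - l\<bar> \<and> \<bar>real k - l\<bar> < S}"
    have finK: "finite K"
      using near_levels(1)[of S l] TS T by (rule_tac finite_subset[of K]) (auto simp: K_def)
    obtain m where m: "\<And>j. mean_profile n j \<le> mean_profile n m" "\<bar>real m - l\<bar> \<le> 5"
      using mean_profile_mode[of n] unfolding l_def by blast
    have "depth_avg n (\<lambda>xs. of_bool (max_level_far n T xs))
        \<le> depth_avg n (\<lambda>xs. of_bool (max_level_far n S xs) + (\<Sum>k\<in>K. of_bool (?Y m xs \<le> ?Y k xs)))"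
    proof (rule depth_avg_mono)
      fix xs :: "nat list"
      show "of_bool (max_level_far n T xs)
          \<le> of_bool (max_level_far n S xs) + (\<Sum>k\<in>K. of_bool (?Y m xs \<le> ?Y k xs) :: real)"
      proof (cases "max_level_far n T xs \<and> \<not> max_level_far n S xs")
        case True
        then obtain k where k: "T \<le> \<bar>real k - l\<bar>" "\<And>j. ?Y j xs \<le> ?Y k xs"
          unfolding max_level_far_def l_def by blast
        have "\<bar>real k - l\<bar> < S" using True k(2) unfolding max_level_far_def l_def by force
        then have "k \<in> K" using k by (simp add: K_def)
        then have "(1 :: real) \<le> (\<Sum>k\<in>K. of_bool (?Y m xs \<le> ?Y k xs))"
          using member_le_sum[of k K "\<lambda>k. of_bool (?Y m xs \<le> ?Y k xs) :: real"] k(2) finK by simp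
        then show ?thesis by simp
      qed (auto intro!: sum_nonneg add_nonneg_nonneg)
    qed
    also have "\<dots> = depth_avg n (\<lambda>xs. of_bool (max_level_far n S xs))
        + (\<Sum>k\<in>K. depth_avg n (\<lambda>xs. of_bool (?Y m xs \<le> ?Y k xs)))"
      by (simp only: depth_avg_add depth_avg_sum)
    also have "\<dots> \<le> C1 * T powr (- B) + (\<Sum>k\<in>K. C2 * T powr (- B) * (1 / (real k - l)\<^sup>2))"
    proof (intro add_mono sum_mono)
      have "depth_avg n (\<lambda>xs. of_bool (max_level_far n S xs)) \<le> C1 * S powr (- B)"
        using T TS S3 by (intro far) (auto simp: l_def)
      also have "\<dots> \<le> C1 * T powr (- B)"
        using C1 T TS B by (intro mult_left_mono powr_mono2') auto
      finally show "depth_avg n (\<lambda>xs. of_bool (max_level_far n S xs)) \<le> C1 * T powr (- B)" .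
      fix k assume k: "k \<in> K"
      define d where "d = \<bar>real k - l\<bar>"
      have d: "T \<le> d" "d < S" using k by (auto simp: K_def d_def)
      have "d ^ 3 \<le> S ^ 3" using d T by (intro power_mono) auto
      then have "depth_avg n (\<lambda>xs. of_bool (?Y m xs \<le> ?Y k xs)) \<le> C2 / d ^ (q + 2)"
        unfolding d_def S3 l_def using d m T by (intro near) (auto simp: l_def d_def)
      also have "\<dots> = C2 * (1 / d ^ q) * (1 / d\<^sup>2)" by (simp add: power_add power2_eq_square)
      also have "1 / d ^ q \<le> 1 / T ^ q"
        using d T by (intro divide_left_mono power_mono) auto
      also have "1 / T ^ q = T powr (- real q)"
        using T by (simp add: powr_minus powr_realpow divide_inverse)
      also have "\<dots> \<le> T powr (- B)" using T q by (intro powr_mono) auto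
      finally have "depth_avg n (\<lambda>xs. of_bool (?Y m xs \<le> ?Y k xs)) \<le> C2 * T powr (- B) * (1 / d\<^sup>2)"
        using C2 by (simp add: mult_left_mono mult_right_mono divide_right_mono)
      then show "depth_avg n (\<lambda>xs. of_bool (?Y m xs \<le> ?Y k xs)) \<le> C2 * T powr (- B) * (1 / (real k - l)\<^sup>2)"
        by (simp add: d_def)
    qed
    also have "\<dots> = C1 * T powr (- B) + C2 * T powr (- B) * (\<Sum>k\<in>K. 1 / (real k - l)\<^sup>2)"
      by (simp add: sum_distrib_left)
    also have "\<dots> \<le> C1 * T powr (- B) + C2 * T powr (- B) * 16"
      using C2 finK T l
      by (intro add_left_mono mult_left_mono sum_inverse_square_dist_le) (auto simp: K_def)
    finally show ?thesis by (simp add: algebra_simps)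
  qed
  moreover have "0 < C1 + 16 * C2" using C1 C2 by simp
  ultimately show ?thesis by blast
qed

theorem theorem1p3:
  fixes B :: real
  assumes "B > 0"
  shows "\<exists>T0>1. \<exists>C>0. \<forall>n\<ge>1. \<forall>kstar :: nat rooted_graph \<Rightarrow> nat.
    (\<forall>t\<in>recursive_trees n. profile n t (kstar t) = width n t) \<longrightarrow>
    (\<forall>T>T0. measure_pmf.prob (random_recursive_tree n) {t. \<bar>real (kstar t) - L n\<bar> \<ge> T}
              \<le> C * T powr (- B))"
proof -
  obtain C where C: "C > 0" and far: "\<And>n T. 12 < T \<Longrightarrow>
    depth_avg n (\<lambda>xs. of_bool (max_level_far n T xs)) \<le> C * T powr (- B)"
    using max_level_far_tail[OF assms] by blast
  \<comment> \<open>\<open>Max\<close> in \<open>width\<close> is meaningful only for a finite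
    range, which holds because profile values are at most \<open>n\<close>.\<close>
  have le_width: "profile n t k \<le> width n t" for n t k
  proof -
    have "profile n t j \<le> n" for j
    proof -
      have "profile n t j \<le> card {1..n}"
        unfolding profile_def by (intro card_mono) auto
      then show ?thesis by simp
    qed
    then have "finite (range (profile n t))"
      by (intro finite_subset[OF _ finite_atMost[of n]]) auto
    then show ?thesis unfolding width_def by (intro Max_ge) auto
  qed
  have "measure_pmf.prob (random_recursive_tree n) {t. \<bar>real (kstar t) - L n\<bar> \<ge> T} \<le> C * T powr (- B)"
    if n: "1 \<le> n" and kstar: "\<And>t. t \<in> recursive_trees n \<Longrightarrow> profile n t (kstar t) = width n t" and T: "12 < T"
    for n T and kstar :: "nat rooted_graph \<Rightarrow> nat"
  proof -
    obtain n' where n': "n = Suc n'" using n by (cases n) auto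
    have "measure_pmf.prob (random_recursive_tree n) {t. \<bar>real (kstar t) - L n\<bar> \<ge> T}
        \<le> depth_avg n' (\<lambda>xs. of_bool (max_level_far n' T xs))"
      unfolding n'
    proof (rule prob_le_depth_avg)
      fix t and xs :: "nat list"
      assume t: "t \<in> recursive_trees (Suc n')" "t \<in> {t. \<bar>real (kstar t) - L (Suc n')\<bar> \<ge> T}"
        and prof: "\<And>k. real (profile (Suc n') t k) = lsum (\<lambda>d. of_bool (d = k)) xs"
      have "lsum (\<lambda>d. of_bool (d = j)) xs \<le> lsum (\<lambda>d. of_bool (d = kstar t)) xs" for j
        using le_width[of "Suc n'" t j] kstar[of t] t unfolding prof[symmetric] n' by simp
      then have "max_level_far n' T xs" using t unfolding max_level_far_def by blast
      then show "(1 :: real) \<le> of_bool (max_level_far n' T xs)" by simp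
    qed simp
    also have "\<dots> \<le> C * T powr (- B)" by (rule far[OF T])
    finally show ?thesis .
  qed
  then show ?thesis using C by (intro exI[of _ 12] exI[of _ C]) auto
qed

end
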